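(* Let $\epsilon_0\in(0,1/2)$ and $r_0\in(2,\infty)$. For every $r>0$ there exists a constant $K=K(r)>0$ (depending on $r$, and on $\epsilon_0,r_0$, but not on $m$ or $\mathbf{p}$) such that the following holds. Let $m\ge1$, let $\mathbf{p}=(p_1,\dots,p_m)$ be a probability mass function with $p_i>0$ for all $i$, and suppose $$\sigma(\mathbf{p})\le\frac{1}{2^{20}},\qquad \frac{p_{\max}}{[\sigma(\mathbf{p})]^{3/2+\epsilon_0}}\le1,\qquad \frac{[\sigma(\mathbf{p})]^{r_0}}{p_{\min}}\le1 .$$ If $\mathcal{T}$ is a random $\mathbf{p}$-tree and $\mathrm{ht}(\mathcal{T})$ its height, then $$\mathbb{P}\Big(\mathrm{ht}(\mathcal{T})\ge\frac{x}{\sigma(\mathbf{p})}\Big)\le\frac{K}{x^r}\qquad\text{for all }x\ge1.$$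
   Context: $\sigma(\mathbf{p})=\sqrt{\sum_{i=1}^m p_i^2}$, $p_{\max}=\max_i p_i$, $p_{\min}=\min_i p_i$. A $\mathbf{p}$-tree is a random rooted tree on vertex set $[m]=\{1,\dots,m\}$ with law $\mathbb{P}_{\mathrm{tree}}(\mathbf{t})=\prod_{v\in[m]}p_v^{d_v(\mathbf{t})}$, where $d_v(\mathbf{t})$ is the number of children of $v$ in the rooted tree $\mathbf{t}$. The height of a rooted tree is the maximal graph distance of a vertex from the root. *)

theory Defs
  imports "HOL-Probability.Probability" "Graph_Theory.Digraph_Component"
begin

text \<open>
  As in the Graph_Theory library, a finite simple graph is a loop-free symmetric digraph, so every
  edge gives rise to a closed walk of length 2 that counts as a \<^const>\<open>pre_digraph.cycle\<close>;
  the cycles of the undirected graph are those of length at least 3.  This is why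
  \<^const>\<open>Digraph_Component.tree\<close> of the library, which forbids all directed cycles, is not used here.
\<close>

definition undirected_tree :: "'a pair_pre_digraph \<Rightarrow> bool" where
  "undirected_tree G \<longleftrightarrow>
     pair_graph G \<and> Digraph_Component.connected (with_proj G) \<and>
     \<not> (\<exists>c. pre_digraph.cycle (with_proj G) c \<and> length c \<ge> 3)"

type_synonym 'a rooted_graph = "'a pair_pre_digraph \<times> 'a"

definition rooted_trees :: "nat \<Rightarrow> nat rooted_graph set" where
  "rooted_trees m = {(G, \<rho>). undirected_tree G \<and> pverts G = {1..m} \<and> \<rho> \<in> {1..m}}"

definition graph_dist :: "'a pair_pre_digraph \<Rightarrow> 'a \<Rightarrow> 'a \<Rightarrow> nat" where
  "graph_dist G u v = (LEAST n. \<exists>q. pre_digraph.awalk (with_proj G) u q v \<and> length q = n)"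

definition height :: "'a rooted_graph \<Rightarrow> nat" where
  "height = (\<lambda>(G, \<rho>). Max (graph_dist G \<rho> ` pverts G))"

text \<open>\<open>w\<close> is a child of \<open>v\<close> if \<open>v\<close> immediately precedes \<open>w\<close> on the path from the root to \<open>w\<close>.\<close>

definition children :: "'a rooted_graph \<Rightarrow> 'a \<Rightarrow> 'a set" where
  "children = (\<lambda>(G, \<rho>) v. {w. \<exists>q. pre_digraph.apath (with_proj G) \<rho> (q @ [(v, w)]) w})"

definition positive_pmf :: "nat \<Rightarrow> (nat \<Rightarrow> real) \<Rightarrow> bool" where
  "positive_pmf m p \<longleftrightarrow> (\<forall>i\<in>{1..m}. p i > 0) \<and> (\<Sum>i=1..m. p i) = 1"

definition sigma :: "nat \<Rightarrow> (nat \<Rightarrow> real) \<Rightarrow> real" where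
  "sigma m p = sqrt (\<Sum>i=1..m. (p i)\<^sup>2)"

definition p_max :: "nat \<Rightarrow> (nat \<Rightarrow> real) \<Rightarrow> real" where
  "p_max m p = Max (p ` {1..m})"

definition p_min :: "nat \<Rightarrow> (nat \<Rightarrow> real) \<Rightarrow> real" where
  "p_min m p = Min (p ` {1..m})"

text \<open>The law of a \<open>p\<close>-tree; its total mass is \<open>(\<Sum>i=1..m. p i) ^ (m - 1)\<close> by Cayley's
  multinomial formula, hence 1 if \<open>p\<close> is a probability mass function.\<close>

definition p_tree_law :: "nat \<Rightarrow> (nat \<Rightarrow> real) \<Rightarrow> nat rooted_graph measure" where
  "p_tree_law m p =
     point_measure (rooted_trees m)
       (\<lambda>t. ennreal (\<Prod>v\<in>{1..m}. p v ^ card (children t v)))"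

end

theory Submission
  imports Defs
begin

text \<open>
  A rooted tree is encoded by its parent map \<open>f\<close>, and its weight becomes \<open>\<Prod> p (f v)\<close> over the vertices
  \<open>v\<close> other than the root.  So parents behave like independent samples from \<open>p\<close>, conditioned on the
  absence of cycles, and Cayley's formula (\<open>forest_mass_eq\<close>) says that this conditioning costs just
  the mass of the roots.  Two consequences carry the proof.

  Chains.  The trees in which \<open>u\<^sub>1, \<dots>, u\<^sub>k\<close> are the successive ancestors of \<open>u\<^sub>0\<close> have total weight
  \<open>p u\<^sub>1 \<cdots> p u\<^sub>k\<close>: contract the chain to one vertex.  In the contracted tree, the vertices hanging from
  the chain form a branching structure, and \<open>light_mass_le\<close> bounds the probability that the chain
  together with everything below it has mass less than \<open>a \<le> 1 / 2\<close> by
  \<open>exp (4 z\<^sup>2 \<sigma>\<^sup>2 a - z p (chain))\<close>, for every \<open>z \<ge> 0\<close>.  Summing over independent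
  \<open>u\<^sub>0, \<dots>, u\<^sub>k\<close> turns the factor \<open>exp (- z p (chain))\<close> into \<open>exp (- z \<sigma>\<^sup>2 (k + 1) / 2)\<close> as long as
  \<open>z p\<^sub>m\<^sub>a\<^sub>x \<le> 1\<close>.  With \<open>z\<close> of order \<open>1 / (\<sigma> \<surd>a)\<close>: an ancestor at distance much more than
  \<open>\<surd>a / \<sigma>\<close> above a typical vertex rarely has a subtree of mass less than \<open>a\<close>.

  Chaining.  On the path from a deepest vertex to the root the mass of the subtree increases from at
  least \<open>p\<^sub>m\<^sub>i\<^sub>n\<close> to \<open>1\<close>.  Cut it at the masses \<open>16\<^sup>-\<^sup>j\<close> and allow \<open>x 2\<^sup>-\<^sup>j / (2 \<sigma>)\<close> steps for the
  passage from mass \<open>16\<^sup>-\<^sup>j\<^sup>-\<^sup>1\<close> to mass \<open>16\<^sup>-\<^sup>j\<close>.  These allowances add up to at most \<open>x / \<sigma>\<close>, so in a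
  tree of height \<open>x / \<sigma>\<close> one of them is exceeded.  If the \<open>j\<close>-th is exceeded by \<open>w\<close>, it is exceeded
  by all vertices below \<open>w\<close>, whose mass is at least \<open>16\<^sup>-\<^sup>j\<^sup>-\<^sup>1\<close>; by Markov's inequality and the chain
  estimate this has probability at most a constant times \<open>16\<^sup>j exp (- c x 2\<^sup>j)\<close>.  These bounds are
  summable in \<open>j\<close>, and their sum decays faster than any power of \<open>x\<close>; there is no logarithmic loss,
  because a union bound over all vertices is replaced by one over pieces of mass \<open>16\<^sup>-\<^sup>j\<^sup>-\<^sup>1\<close>.

  The level \<open>z = 4\<^sup>j / \<sigma>\<close> is admissible while \<open>16\<^sup>j \<le> 1 / \<sigma>\<close>, because \<open>p\<^sub>m\<^sub>a\<^sub>x \<le> \<sigma>\<^sup>3\<^sup>/\<^sup>2\<close>.  From the last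
  level on a plain union bound is good enough: it costs a factor \<open>1 / p\<^sub>m\<^sub>i\<^sub>n\<close>, a power of \<open>1 / \<sigma>\<close>, against
  \<open>exp (- c x / \<sigma>\<^sup>1\<^sup>/\<^sup>4)\<close>.
\<close>

section \<open>Rooted forests as parent maps\<close>

text \<open>
  For a map from \<open>A\<close> into a set of roots together with \<open>A\<close>, this says that iteration leads from every
  vertex of \<open>A\<close> to a root.  The formulation by closed sets survives restriction and gluing of maps
  without any talk of iterates.
\<close>

definition acyclic_on :: "('a \<Rightarrow> 'a) \<Rightarrow> 'a set \<Rightarrow> bool" where
  "acyclic_on f A \<longleftrightarrow> (\<forall>X\<subseteq>A. X \<noteq> {} \<longrightarrow> \<not> f ` X \<subseteq> X)"

definition forests :: "'a set \<Rightarrow> 'a set \<Rightarrow> ('a \<Rightarrow> 'a) set" where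
  "forests C A = {f \<in> A \<rightarrow>\<^sub>E C \<union> A. acyclic_on f A}"

definition forest_mass :: "('a \<Rightarrow> real) \<Rightarrow> 'a set \<Rightarrow> 'a set \<Rightarrow> real" where
  "forest_mass p C A = (\<Sum>f\<in>forests C A. \<Prod>v\<in>A. p (f v))"

lemma acyclic_onD: "acyclic_on f A \<Longrightarrow> X \<subseteq> A \<Longrightarrow> f ` X \<subseteq> X \<Longrightarrow> X = {}"
  by (auto simp: acyclic_on_def)

lemma acyclic_on_cong: "(\<And>v. v \<in> A \<Longrightarrow> f v = g v) \<Longrightarrow> acyclic_on f A \<longleftrightarrow> acyclic_on g A"
proof -
  assume eq: "\<And>v. v \<in> A \<Longrightarrow> f v = g v"
  have "f ` X = g ` X" if "X \<subseteq> A" for X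
    using eq that by (intro image_cong) auto
  then show ?thesis by (simp add: acyclic_on_def)
qed

lemma acyclic_on_subset: "acyclic_on f A \<Longrightarrow> B \<subseteq> A \<Longrightarrow> acyclic_on f B"
  by (auto simp: acyclic_on_def)

lemma finite_forests [simp]: "finite C \<Longrightarrow> finite A \<Longrightarrow> finite (forests C A)"
  unfolding forests_def by (rule finite_subset[of _ "A \<rightarrow>\<^sub>E C \<union> A"]) (auto intro: finite_PiE)

lemma forests_empty [simp]: "forests C {} = {\<lambda>_. undefined}"
  by (auto simp: forests_def acyclic_on_def)

lemma forest_mass_empty [simp]: "forest_mass p C {} = 1"
  by (simp add: forest_mass_def)

lemma forest_mass_no_roots: "A \<noteq> {} \<Longrightarrow> forest_mass p {} A = 0"
proof -
  assume "A \<noteq> {}"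
  then have "forests {} A = {}"
    by (auto simp: forests_def dest!: acyclic_onD[of _ A A])
  then show ?thesis by (simp add: forest_mass_def)
qed

lemma sum_Pow_power:
  fixes a b :: "'b :: comm_semiring_1"
  assumes "finite A"
  shows "(\<Sum>D\<in>Pow A. a ^ card D * b ^ card (A - D)) = (a + b) ^ card A"
  using prod_add[OF assms, of "\<lambda>_. a" "\<lambda>_. b"] by simp

text \<open>
  Split off the first level \<open>D\<close>: its vertices choose their parents freely among the roots, and then
  serve as roots for the remaining vertices.
\<close>

lemma forest_mass_level:
  assumes fin: "finite C" "finite A" and disj: "C \<inter> A = {}"
  shows "forest_mass p C A = (\<Sum>D\<in>Pow A. sum p C ^ card D * forest_mass p D (A - D))"
proof -
  define lev where "lev f = {v \<in> A. f v \<in> C}" for f :: "'a \<Rightarrow> 'a"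
  have "forest_mass p C A =
      (\<Sum>D\<in>Pow A. \<Sum>f\<in>{f \<in> forests C A. lev f = D}. \<Prod>v\<in>A. p (f v))"
    unfolding forest_mass_def using fin by (subst sum.group) (auto simp: lev_def)
  also have "\<dots> = (\<Sum>D\<in>Pow A. sum p C ^ card D * forest_mass p D (A - D))"
  proof (rule sum.cong[OF refl])
    fix D assume "D \<in> Pow A"
    then have D: "D \<subseteq> A" "finite D" using fin finite_subset by auto
    let ?i = "\<lambda>f. (restrict f D, restrict f (A - D))"
    let ?j = "\<lambda>(g, h). restrict (\<lambda>v. if v \<in> D then g v else h v) A"
    have "(\<Sum>f\<in>{f \<in> forests C A. lev f = D}. \<Prod>v\<in>A. p (f v)) =
        (\<Sum>(g, h)\<in>(D \<rightarrow>\<^sub>E C) \<times> forests D (A - D). (\<Prod>v\<in>D. p (g v)) * (\<Prod>v\<in>A - D. p (h v)))"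
    proof (rule sum.reindex_bij_witness[of _ ?j ?i])
      fix f assume f: "f \<in> {f \<in> forests C A. lev f = D}"
      then have fD: "f v \<in> C \<longleftrightarrow> v \<in> D" if "v \<in> A" for v
        using that by (auto simp: lev_def)
      have "f \<in> A \<rightarrow>\<^sub>E C \<union> A" and ac: "acyclic_on f A"
        using f by (auto simp: forests_def)
      then show "?j (?i f) = f"
        by (auto simp: fun_eq_iff PiE_def extensional_def)
      have "acyclic_on (restrict f (A - D)) (A - D)"
        using acyclic_on_subset[OF ac, of "A - D"] acyclic_on_cong[of "A - D" f "restrict f (A - D)"]
        by auto
      then show "?i f \<in> (D \<rightarrow>\<^sub>E C) \<times> forests D (A - D)"
        using fD D \<open>f \<in> A \<rightarrow>\<^sub>E C \<union> A\<close> by (auto simp: forests_def)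
      show "(case ?i f of (g, h) \<Rightarrow> (\<Prod>v\<in>D. p (g v)) * (\<Prod>v\<in>A - D. p (h v))) = (\<Prod>v\<in>A. p (f v))"
        using prod.subset_diff[OF D(1) fin(2), of "\<lambda>v. p (f v)"] by (simp add: mult.commute)
    next
      fix gh assume gh: "gh \<in> (D \<rightarrow>\<^sub>E C) \<times> forests D (A - D)"
      obtain g h where [simp]: "gh = (g, h)" by force
      have g: "g \<in> D \<rightarrow>\<^sub>E C" and h: "h \<in> (A - D) \<rightarrow>\<^sub>E D \<union> (A - D)" and ac: "acyclic_on h (A - D)"
        using gh by (auto simp: forests_def)
      show "?i (?j gh) = gh"
        using g h D by (auto simp: fun_eq_iff PiE_def extensional_def)
      have h': "h v \<in> A" if "v \<in> A" "v \<notin> D" for v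
        using h D that by auto
      have "acyclic_on (?j gh) A"
        unfolding acyclic_on_def
      proof (intro allI impI notI)
        fix X assume X: "X \<subseteq> A" "X \<noteq> {}" "?j gh ` X \<subseteq> X"
        have "v \<notin> D" if "v \<in> X" for v
        proof
          assume "v \<in> D"
          then have "g v \<in> X" using X that D by auto
          moreover have "g v \<in> C" using g \<open>v \<in> D\<close> by auto
          ultimately show False using disj X by auto
        qed
        then have "X \<subseteq> A - D" using X by auto
        moreover then have "h ` X \<subseteq> X" using X by (auto simp: image_subset_iff)
        ultimately show False using acyclic_onD[OF ac] X by auto
      qed
      then show "?j gh \<in> {f \<in> forests C A. lev f = D}"
        using g h h' D disj by (auto simp: forests_def lev_def)
    qed
    also have "\<dots> = (\<Sum>g\<in>D \<rightarrow>\<^sub>E C. \<Prod>v\<in>D. p (g v)) * forest_mass p D (A - D)"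
      by (simp add: forest_mass_def sum_product sum.cartesian_product)
    also have "(\<Sum>g\<in>D \<rightarrow>\<^sub>E C. \<Prod>v\<in>D. p (g v)) = (\<Prod>v\<in>D. sum p C)"
      using D fin by (subst prod_sum_PiE) auto
    finally show "(\<Sum>f\<in>{f \<in> forests C A. lev f = D}. \<Prod>v\<in>A. p (f v)) =
        sum p C ^ card D * forest_mass p D (A - D)" by simp
  qed
  finally show ?thesis .
qed

lemma sum_Pow_power_weighted:
  fixes a b :: real
  assumes "finite A"
  shows "(\<Sum>D\<in>Pow A. a ^ card D * b ^ card (A - D) * sum p D) = sum p A * a * (a + b) ^ (card A - 1)"
proof -
  have "(\<Sum>D\<in>Pow A. a ^ card D * b ^ card (A - D) * sum p D) =
      (\<Sum>D\<in>Pow A. \<Sum>i\<in>A. if i \<in> D then p i * (a ^ card D * b ^ card (A - D)) else 0)"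
  proof (rule sum.cong[OF refl])
    fix D assume "D \<in> Pow A"
    then have "sum p D = (\<Sum>i\<in>A. if i \<in> D then p i else 0)"
      using assms by (simp add: sum.If_cases Int_absorb1)
    then show "a ^ card D * b ^ card (A - D) * sum p D =
        (\<Sum>i\<in>A. if i \<in> D then p i * (a ^ card D * b ^ card (A - D)) else 0)"
      by (auto simp: sum_distrib_right sum_distrib_left mult_ac intro!: sum.cong)
  qed
  also have "\<dots> = (\<Sum>i\<in>A. \<Sum>D\<in>Pow A. if i \<in> D then p i * (a ^ card D * b ^ card (A - D)) else 0)"
    by (rule sum.swap)
  also have "\<dots> = (\<Sum>i\<in>A. p i * a * (a + b) ^ (card A - 1))"
  proof (rule sum.cong[OF refl])
    fix i assume i: "i \<in> A"
    have "(\<Sum>D\<in>Pow A. if i \<in> D then p i * (a ^ card D * b ^ card (A - D)) else 0) =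
        (\<Sum>D\<in>{D \<in> Pow A. i \<in> D}. p i * (a ^ card D * b ^ card (A - D)))"
      using assms by (subst sum.inter_filter[symmetric]) auto
    also have "\<dots> = (\<Sum>D\<in>Pow (A - {i}). p i * a * (a ^ card D * b ^ card (A - {i} - D)))"
    proof (rule sum.reindex_bij_witness[of _ "insert i" "\<lambda>D. D - {i}"])
      fix D assume D: "D \<in> {D \<in> Pow A. i \<in> D}"
      then have "finite D" using assms finite_subset by auto
      then have "card D = Suc (card (D - {i}))" using D by (metis card_Suc_Diff1 mem_Collect_eq)
      moreover have "A - {i} - (D - {i}) = A - D" using D by auto
      ultimately show "p i * a * (a ^ card (D - {i}) * b ^ card (A - {i} - (D - {i}))) =
          p i * (a ^ card D * b ^ card (A - D))" by simp
    qed (use i in auto)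
    also have "\<dots> = p i * a * (a + b) ^ (card A - 1)"
      using sum_Pow_power[of "A - {i}" a b] assms i by (subst sum_distrib_left[symmetric]) simp
    finally show "(\<Sum>D\<in>Pow A. if i \<in> D then p i * (a ^ card D * b ^ card (A - D)) else 0) =
        p i * a * (a + b) ^ (card A - 1)" .
  qed
  finally show ?thesis by (simp add: sum_distrib_right)
qed

text \<open>
  Cayley's formula for forests with a given set of roots.  Multiplying by the total mass avoids the
  exponent \<open>card A - 1\<close>, and thereby a separate treatment of empty \<open>A\<close>.
\<close>

theorem forest_mass_eq:
  assumes "finite C" "finite A" "C \<inter> A = {}" "\<And>i. i \<in> A \<Longrightarrow> p i > 0"
  shows "forest_mass p C A * sum p (C \<union> A) = sum p C * sum p (C \<union> A) ^ card A"
  using assms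
proof (induction "card A" arbitrary: A C rule: less_induct)
  case less
  show ?case
  proof (cases "A = {}")
    case False
    define P q where "P = sum p A" and "q = sum p C"
    have P: "P > 0" unfolding P_def using less.prems False by (intro sum_pos) auto
    have card: "card A = Suc (card A - 1)"
      using False less.prems by (metis Suc_diff_1 card_gt_0_iff)
    have sumCA: "sum p (C \<union> A) = q + P"
      unfolding P_def q_def using less.prems by (intro sum.union_disjoint) auto
    have level: "forest_mass p D (A - D) * P = sum p D * P ^ card (A - D)" if D: "D \<in> Pow A" for D
    proof (cases "D = {}")
      case True
      then show ?thesis using forest_mass_no_roots[OF False] by simp
    next
      case D': False
      have "card (A - D) < card A"
        using D D' less.prems(2) by (intro psubset_card_mono) auto
      moreover have "D \<union> (A - D) = A" using D by auto
      ultimately show ?thesis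
        using less.hyps[of "A - D" D] D less.prems finite_subset[of D A] by (auto simp: P_def)
    qed
    have "forest_mass p C A * P = (\<Sum>D\<in>Pow A. q ^ card D * (forest_mass p D (A - D) * P))"
      using less.prems by (simp add: forest_mass_level q_def sum_distrib_right mult.assoc)
    also have "\<dots> = (\<Sum>D\<in>Pow A. q ^ card D * P ^ card (A - D) * sum p D)"
      by (intro sum.cong refl) (simp add: level)
    also have "\<dots> = P * q * (q + P) ^ (card A - 1)"
      using less.prems sum_Pow_power_weighted[of A q P p] by (simp add: P_def)
    finally have "forest_mass p C A = q * (q + P) ^ (card A - 1)"
      using P by simp
    then show ?thesis
      by (subst card) (simp add: sumCA q_def)
  qed simp
qed

section \<open>The mass that hangs from a set of roots\<close>

lemma exp_minus_le_quadratic: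
  fixes u :: real
  assumes "u \<ge> 0"
  shows "exp (- u) \<le> 1 - u + u\<^sup>2 / 2"
proof -
  have pos: "1 + u + u\<^sup>2 / 2 > 0" using assms by (simp add: add_pos_nonneg)
  have "(1 - u + u\<^sup>2 / 2) * (1 + u + u\<^sup>2 / 2) = 1 + (u\<^sup>2)\<^sup>2 / 4"
    by (simp add: algebra_simps power2_eq_square)
  then have "1 \<le> (1 - u + u\<^sup>2 / 2) * (1 + u + u\<^sup>2 / 2)" by simp
  then have "1 / (1 + u + u\<^sup>2 / 2) \<le> 1 - u + u\<^sup>2 / 2" using pos by (simp add: field_simps)
  moreover have "exp (- u) \<le> 1 / (1 + u + u\<^sup>2 / 2)"
    using exp_lower_Taylor_quadratic[OF assms] pos by (simp add: exp_minus field_simps)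
  ultimately show ?thesis by linarith
qed

text \<open>
  \<open>C\<close> plays the role of a contracted chain in a tree with the vertices \<open>C \<union> S\<close>, and \<open>A\<close> is the set of
  vertices that hang from it.  The factor \<open>sum p (S - A) ^ card (S - A)\<close> is the weight of all trees on
  the remaining vertices, times the choice of the parent of \<open>C\<close> (see \<open>sum_tree_mass\<close> below).
\<close>

definition light_mass :: "('a \<Rightarrow> real) \<Rightarrow> 'a set \<Rightarrow> 'a set \<Rightarrow> real \<Rightarrow> real" where
  "light_mass p C S a =
     (\<Sum>A\<in>{A \<in> Pow S. sum p C + sum p A < a}. forest_mass p C A * sum p (S - A) ^ card (S - A))"

lemma light_mass_no_roots:
  assumes "finite S"
  shows "light_mass p {} S a = (if 0 < a then sum p S ^ card S else 0)"
proof -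
  have "light_mass p {} S a =
      (\<Sum>A\<in>{A \<in> Pow S. sum p {} + sum p A < a}. if A = {} then sum p S ^ card S else 0)"
    unfolding light_mass_def by (rule sum.cong) (auto simp: forest_mass_no_roots)
  then show ?thesis using assms by (simp add: sum.delta)
qed

text \<open>
  The first level \<open>D\<close> below \<open>C\<close> takes over the role of \<open>C\<close>, with the budget \<open>a\<close> reduced by the mass
  of \<open>C\<close>.
\<close>

lemma light_mass_level:
  assumes fin: "finite C" "finite S" and disj: "C \<inter> S = {}"
  shows "light_mass p C S a =
    (\<Sum>D\<in>Pow S. sum p C ^ card D * light_mass p D (S - D) (a - sum p C))"
proof -
  let ?g = "\<lambda>D A. sum p C ^ card D * (forest_mass p D (A - D) * sum p (S - A) ^ card (S - A))"
  let ?h = "\<lambda>D B. sum p C ^ card D *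
    (forest_mass p D B * sum p (S - D - B) ^ card (S - D - B))"
  have finsub: "finite A" if "A \<subseteq> S" for A
    using fin that finite_subset by auto
  have "light_mass p C S a = (\<Sum>A\<in>{A \<in> Pow S. sum p C + sum p A < a}. \<Sum>D\<in>Pow A. ?g D A)"
    unfolding light_mass_def
  proof (rule sum.cong[OF refl])
    fix A assume "A \<in> {A \<in> Pow S. sum p C + sum p A < a}"
    then have "A \<subseteq> S" by auto
    then have "forest_mass p C A = (\<Sum>D\<in>Pow A. sum p C ^ card D * forest_mass p D (A - D))"
      using disj by (intro forest_mass_level[OF fin(1) finsub]) auto
    then show "forest_mass p C A * sum p (S - A) ^ card (S - A) = (\<Sum>D\<in>Pow A. ?g D A)"
      by (simp add: sum_distrib_right mult.assoc)
  qed
  also have "\<dots> = (\<Sum>(A, D)\<in>Sigma {A \<in> Pow S. sum p C + sum p A < a} Pow. ?g D A)"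
    using fin finsub by (subst sum.Sigma) auto
  also have "\<dots> = (\<Sum>(D, B)\<in>Sigma (Pow S)
      (\<lambda>D. {B \<in> Pow (S - D). sum p D + sum p B < a - sum p C}). ?h D B)"
  proof (rule sum.reindex_bij_witness[of _ "\<lambda>(D, B). (D \<union> B, D)" "\<lambda>(A, D). (D, A - D)"])
    fix x assume "x \<in> Sigma {A \<in> Pow S. sum p C + sum p A < a} Pow"
    then obtain A D where x: "x = (A, D)" "A \<subseteq> S" "D \<subseteq> A" "sum p C + sum p A < a" by auto
    have "sum p A = sum p (A - D) + sum p D"
      using sum.subset_diff[OF x(3) finsub[OF x(2)]] .
    then show "(case x of (A, D) \<Rightarrow> (D, A - D)) \<in> Sigma (Pow S)
      (\<lambda>D. {B \<in> Pow (S - D). sum p D + sum p B < a - sum p C})" using x by auto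
    have "S - D - (A - D) = S - A" using x by auto
    then show "(case case x of (A, D) \<Rightarrow> (D, A - D) of (D, B) \<Rightarrow> ?h D B) =
      (case x of (A, D) \<Rightarrow> ?g D A)" using x by simp
  next
    fix y assume "y \<in> Sigma (Pow S) (\<lambda>D. {B \<in> Pow (S - D). sum p D + sum p B < a - sum p C})"
    then obtain D B where y: "y = (D, B)" "D \<subseteq> S" "B \<subseteq> S - D" "sum p D + sum p B < a - sum p C"
      by auto
    have "sum p (D \<union> B) = sum p D + sum p B"
      using y finsub[of D] finsub[of B] by (intro sum.union_disjoint) auto
    then show "(case y of (D, B) \<Rightarrow> (D \<union> B, D)) \<in> Sigma {A \<in> Pow S. sum p C + sum p A < a} Pow"
      using y by auto
  qed auto
  also have "\<dots> = (\<Sum>D\<in>Pow S. \<Sum>B\<in>{B \<in> Pow (S - D). sum p D + sum p B < a - sum p C}. ?h D B)"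
    using fin by (subst sum.Sigma) auto
  finally show ?thesis
    by (simp add: light_mass_def sum_distrib_left)
qed

text \<open>
  The sum over the first level factorises.  Each factor is handled by
  \<open>exp (- u) \<le> 1 - u + u\<^sup>2 / 2\<close>; the linear terms add up to exactly \<open>z\<close>, and the quadratic ones
  produce the sum of squares.
\<close>

lemma prod_tilted_le:
  fixes p :: "'a \<Rightarrow> real"
  assumes S: "finite S" and p: "\<And>i. i \<in> S \<Longrightarrow> p i \<ge> 0" and q: "q \<ge> 0" and P: "P = sum p S" "P > 0"
    and z: "z \<ge> 0"
  shows "(\<Prod>i\<in>S. q * exp (- (z * p i / P)) + P) \<le>
    (q + P) ^ card S * exp (- (q / (q + P)) * (z - z\<^sup>2 * (\<Sum>i\<in>S. (p i)\<^sup>2) / (2 * P\<^sup>2)))"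
proof -
  let ?u = "\<lambda>i. z * p i / P"
  have "(\<Prod>i\<in>S. q * exp (- ?u i) + P) \<le>
      (\<Prod>i\<in>S. (q + P) * exp (- (q / (q + P)) * (?u i - (?u i)\<^sup>2 / 2)))"
  proof (rule prod_mono, intro conjI)
    fix i assume i: "i \<in> S"
    show "0 \<le> q * exp (- ?u i) + P" using q P by simp
    have "?u i \<ge> 0" using z p[OF i] P by simp
    then have "q * exp (- ?u i) + P \<le> q * (1 - ?u i + (?u i)\<^sup>2 / 2) + P"
      using exp_minus_le_quadratic[of "?u i"] q by (intro add_mono mult_left_mono) auto
    also have "\<dots> = (q + P) * (1 + - (q / (q + P)) * (?u i - (?u i)\<^sup>2 / 2))"
    proof -
      have "q + P \<noteq> 0" using q P by linarith
      have "(q + P) * (1 + - (q / (q + P)) * v) = q + P - q * v" for v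
        using \<open>q + P \<noteq> 0\<close> by (simp add: field_simps)
      note this[of "?u i - (?u i)\<^sup>2 / 2"]
      then show ?thesis by (simp only: right_diff_distrib distrib_left mult_1_right)
    qed
    also have "\<dots> \<le> (q + P) * exp (- (q / (q + P)) * (?u i - (?u i)\<^sup>2 / 2))"
      using q P by (intro mult_left_mono exp_ge_add_one_self) auto
    finally show "q * exp (- ?u i) + P \<le> (q + P) * exp (- (q / (q + P)) * (?u i - (?u i)\<^sup>2 / 2))" .
  qed
  also have "\<dots> = (q + P) ^ card S * exp (\<Sum>i\<in>S. - (q / (q + P)) * (?u i - (?u i)\<^sup>2 / 2))"
    unfolding prod.distrib exp_sum[OF S] prod_constant ..
  also have "(\<Sum>i\<in>S. - (q / (q + P)) * (?u i - (?u i)\<^sup>2 / 2)) =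
      - (q / (q + P)) * (z - z\<^sup>2 * (\<Sum>i\<in>S. (p i)\<^sup>2) / (2 * P\<^sup>2))"
  proof -
    have "(\<Sum>i\<in>S. ?u i) = z * (sum p S) / P"
      unfolding sum_distrib_left sum_divide_distrib ..
    then have 1: "(\<Sum>i\<in>S. ?u i) = z" using P by simp
    have 2: "(\<Sum>i\<in>S. (?u i)\<^sup>2 / 2) = z\<^sup>2 * (\<Sum>i\<in>S. (p i)\<^sup>2) / (2 * P\<^sup>2)"
      unfolding sum_distrib_left sum_divide_distrib
      by (intro sum.cong refl) (simp add: power_mult_distrib power_divide)
    show ?thesis
      unfolding sum_distrib_left[symmetric] sum_subtractf 1 2 ..
  qed
  finally show ?thesis .
qed

text \<open>
  Level by level, the mass of the current level, relative to the mass that has not yet been explored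
  (the level included), is a martingale, and \<open>exp (- z q / t)\<close> is its exponential: normalising \<open>q\<close> by \<open>t\<close> is what makes the
  linear terms cancel.  The second order error per level is at most \<open>\<theta>\<close> times the mass of that level,
  because the unexplored mass never drops below \<open>t - a\<close> within the budget; so it is paid for by
  \<open>exp (\<theta> a)\<close>.  The alternative \<open>z = 0\<close> is the statement that the weights have total mass at most
  \<open>t ^ card S\<close>, whatever the budget.
\<close>

theorem light_mass_le:
  assumes fin: "finite C" "finite S" and disj: "C \<inter> S = {}"
    and p: "\<And>i. i \<in> C \<union> S \<Longrightarrow> p i > 0"
    and t: "t = sum p C + sum p S" and \<theta>: "\<theta> \<ge> 0" and z: "z \<ge> 0"
    and cond: "z = 0 \<or> a < t \<and> z\<^sup>2 * (\<Sum>i\<in>S. (p i)\<^sup>2) \<le> 2 * \<theta> * (t - a) ^ 3"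
  shows "light_mass p C S a \<le> t ^ card S * exp (\<theta> * a - z * sum p C / t)"
  using assms
proof (induction "card S" arbitrary: S C t a rule: less_induct)
  case less
  define q P where "q = sum p C" and "P = sum p S"
  have q: "q \<ge> 0" unfolding q_def using less.prems(4) by (intro sum_nonneg) (simp add: less_imp_le)
  have P: "P \<ge> 0" unfolding P_def using less.prems(4) by (intro sum_nonneg) (simp add: less_imp_le)
  have t: "t = q + P" using less.prems by (simp add: q_def P_def)
  consider (heavy) "a \<le> q" | (leaf) "q < a" "S = {}" | (step) "q < a" "S \<noteq> {}" by linarith
  then show ?case
  proof cases
    case heavy
    have "sum p A \<ge> 0" if "A \<in> Pow S" for A
      using that less.prems(4) by (intro sum_nonneg) (auto simp: less_imp_le)
    then have "\<not> sum p C + sum p A < a" if "A \<in> Pow S" for A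
      using heavy that unfolding q_def by (meson add_increasing2 leD order_trans)
    then have "{A \<in> Pow S. sum p C + sum p A < a} = {}" by blast
    then have "light_mass p C S a = 0" unfolding light_mass_def by (simp only: sum.empty)
    then show ?thesis using q P t by simp
  next
    case leaf
    then have "z = 0" using less.prems t by (auto simp: P_def)
    have "light_mass p C S a = 1"
    proof -
      have "{A \<in> Pow S. sum p C + sum p A < a} = {{}}" using leaf by (auto simp: q_def)
      then show ?thesis using leaf by (simp add: light_mass_def)
    qed
    also have "\<dots> \<le> exp (\<theta> * a)" using leaf q \<theta> by simp
    finally show ?thesis using leaf \<open>z = 0\<close> by simp
  next
    case step
    have P: "P > 0"
      unfolding P_def using step less.prems by (intro sum_pos) auto
    let ?V = "\<Sum>i\<in>S. (p i)\<^sup>2"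
    \<comment> \<open>The induction covers all levels but the empty one, where nothing hangs from \<open>C\<close>.\<close>
    have level: "light_mass p D (S - D) (a - q) \<le>
        P ^ card (S - D) * exp (\<theta> * (a - q) - z * sum p D / P)" if D: "D \<in> Pow S" for D
    proof (cases "D = {}")
      case True
      then show ?thesis
        using step P \<theta> less.prems(2) by (simp add: light_mass_no_roots P_def)
    next
      case False
      have fD: "finite D" using D less.prems(2) finite_subset by auto
      have "(\<Sum>i\<in>S - D. (p i)\<^sup>2) \<le> ?V"
        using less.prems(2) by (intro sum_mono2) auto
      then have mono: "z\<^sup>2 * (\<Sum>i\<in>S - D. (p i)\<^sup>2) \<le> z\<^sup>2 * ?V" by (intro mult_left_mono) auto
      have cond: "z = 0 \<or> a - q < P \<and>
          z\<^sup>2 * (\<Sum>i\<in>S - D. (p i)\<^sup>2) \<le> 2 * \<theta> * (P - (a - q)) ^ 3"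
      proof -
        have "P - (a - q) = t - a" using t by simp
        moreover have "a < t \<Longrightarrow> a - q < P" using t by simp
        ultimately show ?thesis using less.prems(8) order_trans[OF mono] by metis
      qed
      show ?thesis
      proof (rule less.hyps)
        show "card (S - D) < card S"
          using D False less.prems(2) by (intro psubset_card_mono) auto
        show "P = sum p D + sum p (S - D)"
          using D sum.subset_diff[of D S p] less.prems(2) by (auto simp: P_def)
      qed (use D fD less.prems cond in auto)
    qed
    have "light_mass p C S a \<le>
        (\<Sum>D\<in>Pow S. q ^ card D * (P ^ card (S - D) * exp (\<theta> * (a - q) - z * sum p D / P)))"
      unfolding light_mass_level[OF less.prems(1-3)] q_def[symmetric]
      using level q by (intro sum_mono mult_left_mono) auto
    also have "\<dots> = exp (\<theta> * (a - q)) *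
        (\<Sum>D\<in>Pow S. (\<Prod>i\<in>D. q * exp (- (z * p i / P))) * (\<Prod>i\<in>S - D. P))"
      (is "_ = ?E * sum ?F _")
    proof (subst sum_distrib_left[of ?E ?F], rule sum.cong[OF refl])
      fix D assume "D \<in> Pow S"
      then have "finite D" using less.prems(2) finite_subset by auto
      then have "exp (- (z * sum p D / P)) = (\<Prod>i\<in>D. exp (- (z * p i / P)))"
        by (simp only: exp_sum[symmetric] sum_negf sum_distrib_left sum_divide_distrib)
      moreover have "exp (\<theta> * (a - q) - z * sum p D / P) =
          exp (\<theta> * (a - q)) * exp (- (z * sum p D / P))"
        by (simp only: diff_conv_add_uminus exp_add)
      ultimately show "q ^ card D * (P ^ card (S - D) * exp (\<theta> * (a - q) - z * sum p D / P)) =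
          exp (\<theta> * (a - q)) * ((\<Prod>i\<in>D. q * exp (- (z * p i / P))) * (\<Prod>i\<in>S - D. P))"
        by (simp only: prod.distrib prod_constant mult_ac)
    qed
    also have "\<dots> = exp (\<theta> * (a - q)) * (\<Prod>i\<in>S. q * exp (- (z * p i / P)) + P)"
      using less.prems(2) by (simp add: prod_add)
    also have "\<dots> \<le> exp (\<theta> * (a - q)) *
        (t ^ card S * exp (- (q / t) * (z - z\<^sup>2 * ?V / (2 * P\<^sup>2))))"
      unfolding t using P q less.prems
      by (intro mult_left_mono prod_tilted_le) (auto simp: P_def less_imp_le)
    also have "\<dots> = t ^ card S * exp (\<theta> * (a - q) - (q / t) * (z - z\<^sup>2 * ?V / (2 * P\<^sup>2)))"
      by (simp only: diff_conv_add_uminus[of "\<theta> * (a - q)"] exp_add mult_minus_left mult_ac)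
    also have "\<dots> \<le> t ^ card S * exp (\<theta> * a - z * q / t)"
    proof -
      have "z\<^sup>2 * ?V / (2 * P\<^sup>2 * t) \<le> \<theta>"
      proof (cases "z = 0")
        case False
        then have c: "a < t" "z\<^sup>2 * ?V \<le> 2 * \<theta> * (t - a) ^ 3" using less.prems(8) by auto
        have "(t - a) ^ 3 = (t - a)\<^sup>2 * (t - a)" by (simp add: power3_eq_cube power2_eq_square)
        also have "\<dots> \<le> P\<^sup>2 * t"
          using c step q P t by (intro mult_mono power_mono) auto
        finally have "2 * \<theta> * (t - a) ^ 3 \<le> 2 * \<theta> * (P\<^sup>2 * t)"
          using \<theta> by (intro mult_left_mono) auto
        then have "z\<^sup>2 * ?V \<le> \<theta> * (2 * P\<^sup>2 * t)" using c by (simp add: mult_ac)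
        moreover have "2 * P\<^sup>2 * t > 0" using P q t by simp
        ultimately show ?thesis by (simp add: divide_le_eq)
      qed (use \<theta> in simp)
      then have "q * (z\<^sup>2 * ?V / (2 * P\<^sup>2 * t)) \<le> q * \<theta>"
        using q by (rule mult_left_mono)
      moreover have "(q / t) * (z - z\<^sup>2 * ?V / (2 * P\<^sup>2)) = z * q / t - q * (z\<^sup>2 * ?V / (2 * P\<^sup>2 * t))"
        by (simp add: right_diff_distrib mult_ac)
      ultimately have "\<theta> * (a - q) - (q / t) * (z - z\<^sup>2 * ?V / (2 * P\<^sup>2)) \<le> \<theta> * a - z * q / t"
        by (simp add: algebra_simps)
      then show ?thesis using t P q by (intro mult_left_mono) auto
    qed
    finally show ?thesis by (simp add: q_def)
  qed
qed

section \<open>Trees with a prescribed chain of ancestors\<close>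

lemma sum_le_inj:
  fixes g :: "'b \<Rightarrow> real"
  assumes "inj_on \<phi> S" "\<phi> ` S \<subseteq> T" "finite T"
    and "\<And>y. y \<in> T \<Longrightarrow> g y \<ge> 0" "\<And>x. x \<in> S \<Longrightarrow> w x \<le> g (\<phi> x)"
  shows "sum w S \<le> sum g T"
proof -
  have "sum w S \<le> sum (g \<circ> \<phi>) S" using assms by (intro sum_mono) auto
  also have "\<dots> = sum g (\<phi> ` S)" using assms(1) by (simp add: sum.reindex)
  also have "\<dots> \<le> sum g T" using assms by (intro sum_mono2) auto
  finally show ?thesis .
qed

text \<open>
  The root is a fixed point of the parent map, so that iterates never leave \<open>V\<close>; it contributes no
  factor to the weight.
\<close>

definition rtrees :: "'a set \<Rightarrow> ('a \<times> ('a \<Rightarrow> 'a)) set" where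
  "rtrees V = {(\<rho>, f). \<rho> \<in> V \<and> f \<in> V \<rightarrow>\<^sub>E V \<and> f \<rho> = \<rho> \<and> acyclic_on f (V - {\<rho>})}"

definition rtree_weight :: "('a \<Rightarrow> real) \<Rightarrow> 'a set \<Rightarrow> 'a \<times> ('a \<Rightarrow> 'a) \<Rightarrow> real" where
  "rtree_weight p V = (\<lambda>(\<rho>, f). \<Prod>v\<in>V - {\<rho>}. p (f v))"

definition subtree :: "'a set \<Rightarrow> ('a \<Rightarrow> 'a) \<Rightarrow> 'a \<Rightarrow> 'a set" where
  "subtree V f z = {v \<in> V. \<exists>n. (f ^^ n) v = z}"

definition ancestors :: "('a \<Rightarrow> 'a) \<Rightarrow> nat \<Rightarrow> 'a \<Rightarrow> 'a list" where
  "ancestors f k v = map (\<lambda>i. (f ^^ i) v) [0..<Suc k]"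

definition depth_ge :: "'a \<times> ('a \<Rightarrow> 'a) \<Rightarrow> nat \<Rightarrow> 'a \<Rightarrow> bool" where
  "depth_ge = (\<lambda>(\<rho>, f) k v. \<forall>i<k. (f ^^ i) v \<noteq> \<rho>)"

lemma finite_rtrees [simp]: "finite V \<Longrightarrow> finite (rtrees V)"
  by (rule finite_subset[of _ "V \<times> (V \<rightarrow>\<^sub>E V)"]) (auto simp: rtrees_def intro: finite_PiE)

lemma rtree_weight_nonneg:
  assumes "t \<in> rtrees V" "\<And>i. i \<in> V \<Longrightarrow> p i > 0"
  shows "rtree_weight p V t \<ge> 0"
proof -
  have "p i \<ge> 0" if "i \<in> V" for i using assms(2)[OF that] by simp
  then show ?thesis using assms(1) by (auto simp: rtree_weight_def rtrees_def intro!: prod_nonneg)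
qed

locale rtree =
  fixes V :: "'a set" and \<rho> :: 'a and f :: "'a \<Rightarrow> 'a"
  assumes in_rtrees: "(\<rho>, f) \<in> rtrees V"
begin

lemma root_in: "\<rho> \<in> V" and f_root [simp]: "f \<rho> = \<rho>" and f_in [simp]: "v \<in> V \<Longrightarrow> f v \<in> V"
  and acyclic: "acyclic_on f (V - {\<rho>})" and f_ext: "v \<notin> V \<Longrightarrow> f v = undefined"
  using in_rtrees by (auto simp: rtrees_def)

lemma iter_in [simp]: "v \<in> V \<Longrightarrow> (f ^^ n) v \<in> V"
  by (induction n) auto

lemma iter_root [simp]: "(f ^^ n) \<rho> = \<rho>"
  by (induction n) auto

lemma reaches_root:
  assumes "v \<in> V"
  shows "\<exists>n. (f ^^ n) v = \<rho>"
proof (rule ccontr)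
  assume neg: "\<nexists>n. (f ^^ n) v = \<rho>"
  let ?X = "range (\<lambda>n. (f ^^ n) v)"
  have "?X \<subseteq> V - {\<rho>}" using neg assms by auto
  moreover have "f ` ?X \<subseteq> ?X"
  proof
    fix y assume "y \<in> f ` ?X"
    then obtain n where "y = (f ^^ Suc n) v" by auto
    then show "y \<in> ?X" by blast
  qed
  ultimately show False using acyclic_onD[OF acyclic] by blast
qed

lemma periodic_imp_root:
  assumes "z \<in> V" "(f ^^ Suc n) z = z"
  shows "z = \<rho>"
proof -
  obtain i where i: "(f ^^ i) z = \<rho>" using reaches_root[OF assms(1)] by blast
  have "(f ^^ (Suc n * k)) z = z" for k
  proof (induction k)
    case (Suc k)
    have "(f ^^ (Suc n * Suc k)) z = (f ^^ (Suc n * k)) ((f ^^ Suc n) z)"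
      by (subst mult_Suc_right, subst add.commute, simp only: funpow_add o_apply)
    then show ?case using Suc assms by simp
  qed simp
  then have "z = (f ^^ (Suc n * i)) z" by simp
  also have "Suc n * i = n * i + i" by simp
  also have "(f ^^ (n * i + i)) z = \<rho>" by (simp only: funpow_add o_apply i iter_root)
  finally show ?thesis .
qed

lemma distinct_ancestors:
  assumes "v \<in> V" "depth_ge (\<rho>, f) k v"
  shows "distinct (ancestors f k v)"
proof -
  have neq: "(f ^^ i) v \<noteq> (f ^^ j) v" if ij: "i < j" "j \<le> k" for i j
  proof
    assume eq: "(f ^^ i) v = (f ^^ j) v"
    obtain d where "j = Suc (i + d)" using less_imp_Suc_add[OF ij(1)] by blast
    then have j: "j = Suc d + i" by simp
    have "(f ^^ Suc d) ((f ^^ i) v) = (f ^^ j) v" unfolding j by (simp only: funpow_add o_apply)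
    then have "(f ^^ Suc d) ((f ^^ i) v) = (f ^^ i) v" using eq by (rule trans[OF _ sym])
    then have "(f ^^ i) v = \<rho>" by (rule periodic_imp_root[OF iter_in[OF assms(1)]])
    then show False using assms(2) ij by (auto simp: depth_ge_def)
  qed
  have "inj_on (\<lambda>i. (f ^^ i) v) {0..<Suc k}"
  proof (rule linorder_inj_onI)
    fix i j assume "i < j" "i \<in> {0..<Suc k}" "j \<in> {0..<Suc k}"
    then show "(f ^^ i) v \<noteq> (f ^^ j) v" using neq by auto
  qed auto
  then show ?thesis by (simp add: ancestors_def distinct_map del: upt_Suc)
qed

lemma subtree_self: "z \<in> V \<Longrightarrow> z \<in> subtree V f z"
  unfolding subtree_def by (auto intro!: exI[of _ 0])

lemma subtree_subset: "subtree V f z \<subseteq> V"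
  by (auto simp: subtree_def)

lemma subtree_step_iff:
  assumes "v \<in> V" "v \<noteq> z"
  shows "f v \<in> subtree V f z \<longleftrightarrow> v \<in> subtree V f z"
proof
  assume "f v \<in> subtree V f z"
  then obtain n where "(f ^^ n) (f v) = z" by (auto simp: subtree_def)
  then have "(f ^^ Suc n) v = z" by (simp add: funpow_swap1)
  then show "v \<in> subtree V f z" using assms unfolding subtree_def by blast
next
  assume "v \<in> subtree V f z"
  then obtain n where n: "(f ^^ n) v = z" by (auto simp: subtree_def)
  with assms obtain m where "n = Suc m" by (cases n) auto
  with n have "(f ^^ m) (f v) = z" by (simp add: funpow_swap1)
  then show "f v \<in> subtree V f z" using assms by (auto simp: subtree_def)
qed

lemma root_in_subtree_iff: "z \<in> V \<Longrightarrow> \<rho> \<in> subtree V f z \<longleftrightarrow> z = \<rho>"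
  using root_in by (auto simp: subtree_def)

lemma subtree_root: "subtree V f \<rho> = V"
  using reaches_root by (auto simp: subtree_def)

lemma parent_notin_subtree:
  assumes "z \<in> V" "z \<noteq> \<rho>"
  shows "f z \<notin> subtree V f z"
proof
  assume "f z \<in> subtree V f z"
  then obtain n where "(f ^^ n) (f z) = z" by (auto simp: subtree_def)
  then have "(f ^^ Suc n) z = z" by (simp add: funpow_swap1)
  then show False using periodic_imp_root assms by blast
qed

end

lemma length_ancestors [simp]: "length (ancestors f k v) = Suc k"
  by (simp add: ancestors_def)

lemma ancestors_nth: "i \<le> k \<Longrightarrow> ancestors f k v ! i = (f ^^ i) v"
  by (simp add: ancestors_def del: upt_Suc)

lemma hd_ancestors [simp]: "hd (ancestors f k v) = v"
  by (simp add: ancestors_def upt_conv_Cons del: upt_Suc)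

lemma last_ancestors [simp]: "last (ancestors f k v) = (f ^^ k) v"
  by (simp add: ancestors_def)

lemma map_butlast_ancestors: "map f (butlast (ancestors f k v)) = tl (ancestors f k v)"
  by (rule nth_equalityI) (auto simp: nth_butlast nth_tl ancestors_nth)

text \<open>
  Sum Cayley's formula over the possible roots; the extra factor \<open>sum p R\<close> accounts for a vertex
  outside \<open>R\<close> that chooses its parent in \<open>R\<close>.
\<close>

lemma sum_tree_mass:
  assumes "finite R" "R \<noteq> {}" "\<And>i. i \<in> R \<Longrightarrow> p i > 0"
  shows "sum p R * (\<Sum>\<rho>\<in>R. forest_mass p {\<rho>} (R - {\<rho>})) = sum p R ^ card R"
proof -
  have "(\<Sum>\<rho>\<in>R. forest_mass p {\<rho>} (R - {\<rho>}) * sum p R) = (\<Sum>\<rho>\<in>R. p \<rho> * sum p R ^ (card R - 1))"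
  proof (rule sum.cong[OF refl])
    fix \<rho> assume "\<rho> \<in> R"
    then show "forest_mass p {\<rho>} (R - {\<rho>}) * sum p R = p \<rho> * sum p R ^ (card R - 1)"
      using forest_mass_eq[of "{\<rho>}" "R - {\<rho>}" p] assms by (simp add: insert_absorb)
  qed
  also have "\<dots> = sum p R ^ Suc (card R - 1)" by (simp add: sum_distrib_right[symmetric])
  also have "Suc (card R - 1) = card R" using assms by (simp add: card_gt_0_iff)
  finally show ?thesis unfolding sum_distrib_right[symmetric] by (simp only: mult.commute)
qed

definition light_ancestor_trees :: "('a \<Rightarrow> real) \<Rightarrow> 'a set \<Rightarrow> nat \<Rightarrow> real \<Rightarrow> 'a \<Rightarrow> ('a \<times> ('a \<Rightarrow> 'a)) set" where
  "light_ancestor_trees p V k a v = {(\<rho>, f) \<in> rtrees V. depth_ge (\<rho>, f) k v \<and> sum p (subtree V f ((f ^^ k) v)) < a}"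

text \<open>
  A tree in which exactly \<open>A\<close> hangs from the chain \<open>us\<close> is determined by three independent pieces: a
  forest on \<open>A\<close> rooted in the chain, the parent of the top of the chain, and a rooted tree on the
  remaining vertices.  The last two are absent if no vertices remain, and then the top is the root.
\<close>

lemma chain_subtree_mass:
  assumes V: "finite V" and p: "\<And>i. i \<in> V \<Longrightarrow> p i > 0"
    and us: "distinct us" "set us \<subseteq> V" "us \<noteq> []" and A: "A \<subseteq> V - set us"
  shows "(\<Sum>t\<in>{(\<rho>, f) \<in> rtrees V. ancestors f (length us - 1) (hd us) = us \<and>
        depth_ge (\<rho>, f) (length us - 1) (hd us) \<and> subtree V f (last us) = set us \<union> A}. rtree_weight p V t)
    \<le> prod_list (map p (tl us)) * (forest_mass p (set us) A * sum p (V - set us - A) ^ card (V - set us - A))"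
proof -
  define R where "R = V - set us - A"
  define z where "z = last us"
  define B where "B = set (butlast us)"
  define k where "k = length us - 1"
  define P where "P = prod_list (map p (tl us))"
  define T where "T = {(\<rho>, f) \<in> rtrees V. ancestors f k (hd us) = us \<and>
        depth_ge (\<rho>, f) k (hd us) \<and> subtree V f z = set us \<union> A}"
  have us_eq: "us = butlast us @ [z]" using us by (simp add: z_def)
  then have setus: "set us = insert z B" unfolding B_def by (metis list.set(1,2) set_append Un_insert_right sup_bot.right_neutral)
  have zB: "z \<notin> B" using us(1) us_eq unfolding B_def by (metis distinct_butlast not_distinct_conv_prefix us(1) append_butlast_last_id)
  have finA: "finite A" "finite R" "finite B" using A V finite_subset by (auto simp: R_def B_def)
  have zV: "z \<in> V" "B \<subseteq> V" using us setus by auto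
  have part: "V = insert z B \<union> A \<union> R" "A \<inter> R = {}" "insert z B \<inter> A = {}" "insert z B \<inter> R = {}"
    using A us setus by (auto simp: R_def)
  have P0: "P \<ge> 0" unfolding P_def
    using us p by (intro prod_list_nonneg) (auto dest!: list.set_sel(2)[OF us(3)] intro!: less_imp_le)
  have fnonneg: "(\<Prod>v\<in>X. p (g v)) \<ge> 0" if "g \<in> X \<rightarrow> V" for X g
    using that p by (intro prod_nonneg) (auto intro: less_imp_le)
  have tree: "rtree V \<rho> f" if "(\<rho>, f) \<in> T" for \<rho> f
    using that by (simp add: rtree_def T_def)
  have mapB: "map f (butlast us) = tl us" if "(\<rho>, f) \<in> T" for \<rho> f
    using that map_butlast_ancestors[of f k "hd us"] by (auto simp: T_def)
  have prodB: "(\<Prod>v\<in>B. p (f v)) = P" if "(\<rho>, f) \<in> T" for \<rho> f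
  proof -
    have "(\<Prod>v\<in>B. p (f v)) = prod_list (map (\<lambda>v. p (f v)) (butlast us))"
      unfolding B_def using us by (intro prod.distinct_set_conv_list) (simp add: distinct_butlast)
    also have "map (\<lambda>v. p (f v)) (butlast us) = map p (tl us)"
      by (simp add: mapB[OF that, symmetric] comp_def)
    finally show ?thesis by (simp add: P_def)
  qed
  have eqB: "f v = f' v" if "(\<rho>, f) \<in> T" "(\<rho>', f') \<in> T" "v \<in> B" for \<rho> f \<rho>' f' v
    using mapB[OF that(1)] mapB[OF that(2)] that(3) unfolding B_def by (metis map_eq_conv)
  have forestA: "restrict f A \<in> forests (set us) A" and rootA: "\<rho> \<notin> A" "\<rho> \<notin> B"
    and rootR: "\<rho> = z \<longleftrightarrow> R = {}" if t: "(\<rho>, f) \<in> T" for \<rho> f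
  proof -
    interpret rtree V \<rho> f by (rule tree[OF t])
    have st: "subtree V f z = set us \<union> A" using t by (simp add: T_def)
    show rA: "\<rho> \<notin> A" using root_in_subtree_iff[OF zV(1)] st part setus by auto
    show "\<rho> \<notin> B"
      using root_in_subtree_iff[OF zV(1)] st setus zB by auto
    have "f v \<in> set us \<union> A" if "v \<in> A" for v
      using subtree_step_iff[of v z] that st part by auto
    moreover have "acyclic_on (restrict f A) A"
      using acyclic_on_subset[OF acyclic, of A] rA part acyclic_on_cong[of A f "restrict f A"] by auto
    ultimately show "restrict f A \<in> forests (set us) A" by (auto simp: forests_def)
    show "\<rho> = z \<longleftrightarrow> R = {}"
    proof
      assume "\<rho> = z"
      then have "set us \<union> A = V" using st subtree_root by simp
      then show "R = {}" by (auto simp: R_def)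
    next
      assume "R = {}"
      then have "\<rho> \<in> subtree V f z" using root_in part st setus by auto
      then show "\<rho> = z" using root_in_subtree_iff[OF zV(1)] by simp
    qed
  qed
  have fm: "forest_mass p (set us) A = (\<Sum>g\<in>forests (set us) A. \<Prod>v\<in>A. p (g v))"
    by (simp add: forest_mass_def)
  have gA: "g \<in> A \<rightarrow> V" if "g \<in> forests (set us) A" for g
    using that us A by (force simp: forests_def)
  have "sum (rtree_weight p V) T \<le> P * (forest_mass p (set us) A * sum p R ^ card R)"
  proof (cases "R = {}")
    case True
    have "sum (rtree_weight p V) T \<le> (\<Sum>g\<in>forests (set us) A. P * (\<Prod>v\<in>A. p (g v)))"
    proof (rule sum_le_inj[where \<phi> = "\<lambda>(\<rho>, f). restrict f A"])
      show "inj_on (\<lambda>(\<rho>, f). restrict f A) T"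
      proof (rule inj_onI, clarify)
        fix \<rho> f \<rho>' f' assume t: "(\<rho>, f) \<in> T" and t': "(\<rho>', f') \<in> T" and eq: "restrict f A = restrict f' A"
        have r: "\<rho> = z" "\<rho>' = z" using rootR t t' True by auto
        interpret t: rtree V z f using tree[OF t] r by simp
        interpret t': rtree V z f' using tree[OF t'] r by simp
        have "f v = f' v" for v
        proof -
          consider "v \<in> A" | "v \<in> B" | "v = z" | "v \<notin> V" using part True by auto
          then show ?thesis
            by cases (use eqB[OF t t'] eq in \<open>auto simp: t.f_ext t'.f_ext dest: fun_cong[of _ _ v]\<close>)
        qed
        then show "\<rho> = \<rho>' \<and> f = f'" using r by auto
      qed
      fix t assume t: "t \<in> T"
      obtain \<rho> f where [simp]: "t = (\<rho>, f)" by force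
      have "V - {\<rho>} = B \<union> A" using rootR t True part zB by auto
      then have "(\<Prod>v\<in>V - {\<rho>}. p (f v)) = (\<Prod>v\<in>B. p (f v)) * (\<Prod>v\<in>A. p (f v))"
        using finA part by (simp add: prod.union_disjoint)
      then show "rtree_weight p V t \<le> P * (\<Prod>v\<in>A. p ((case t of (\<rho>, f) \<Rightarrow> restrict f A) v))"
        using prodB t by (simp add: rtree_weight_def)
    qed (use forestA finA P0 fnonneg[OF gA] in auto)
    then show ?thesis using True by (simp add: fm sum_distrib_left)
  next
    case False
    let ?\<phi> = "\<lambda>(\<rho>, f). (restrict f A, f z, \<rho>, restrict f (R - {\<rho>}))"
    let ?rest = "Sigma R (\<lambda>\<rho>. forests {\<rho>} (R - {\<rho>}))"
    let ?U = "forests (set us) A \<times> R \<times> ?rest"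
    let ?g = "\<lambda>(g, y, \<rho>, h). (P * (\<Prod>v\<in>A. p (g v))) * (p y * (\<Prod>v\<in>R - {\<rho>}. p (h v)))"
    have zR: "\<rho> \<in> R" "f z \<in> R" "restrict f (R - {\<rho>}) \<in> forests {\<rho>} (R - {\<rho>})"
      if t: "(\<rho>, f) \<in> T" for \<rho> f
    proof -
      interpret rtree V \<rho> f by (rule tree[OF t])
      have nz: "\<rho> \<noteq> z" using rootR[OF t] False by simp
      have st: "subtree V f z = set us \<union> A" using t by (simp add: T_def)
      show rR: "\<rho> \<in> R" using root_in nz rootA[OF t] part by auto
      show "f z \<in> R"
        using parent_notin_subtree[of z] nz zV(1) f_in[of z] st unfolding R_def by auto
      have "f v \<in> R" if "v \<in> R" for v
      proof -
        have v: "v \<in> V" "v \<noteq> z" "v \<notin> subtree V f z" using that st setus unfolding R_def by auto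
        then have "f v \<notin> subtree V f z" "f v \<in> V" using subtree_step_iff by auto
        then show ?thesis using st unfolding R_def by auto
      qed
      moreover have "acyclic_on (restrict f (R - {\<rho>})) (R - {\<rho>})"
        using acyclic_on_subset[OF acyclic, of "R - {\<rho>}"] part
          acyclic_on_cong[of "R - {\<rho>}" f "restrict f (R - {\<rho>})"] by auto
      ultimately show "restrict f (R - {\<rho>}) \<in> forests {\<rho>} (R - {\<rho>})" by (auto simp: forests_def)
    qed
    have "sum (rtree_weight p V) T \<le> sum ?g ?U"
    proof (rule sum_le_inj[where \<phi> = ?\<phi>])
      show "inj_on ?\<phi> T"
      proof (rule inj_onI, clarsimp)
        fix \<rho> f f' assume t: "(\<rho>, f) \<in> T" and t': "(\<rho>, f') \<in> T"
          and eq: "restrict f A = restrict f' A" "f z = f' z" "restrict f (R - {\<rho>}) = restrict f' (R - {\<rho>})"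
        interpret t: rtree V \<rho> f by (rule tree[OF t])
        interpret t': rtree V \<rho> f' by (rule tree[OF t'])
        show "f = f'"
        proof
          fix v
          consider "v \<in> A" | "v \<in> B" | "v = z" | "v \<notin> V" | "v \<in> R - {\<rho>}" | "v = \<rho>" using part by auto
          then show "f v = f' v"
          proof cases
            case 1 then show ?thesis using fun_cong[OF eq(1), of v] by simp
          next
            case 2 then show ?thesis using eqB[OF t t'] by simp
          next
            case 5 then show ?thesis using fun_cong[OF eq(3), of v] by simp
          qed (auto simp: eq t.f_ext t'.f_ext)
        qed
      qed
      show "finite ?U" using finA by (intro finite_cartesian_product finite_SigmaI) auto
      show "?g y \<ge> 0" if "y \<in> ?U" for y
      proof -
        obtain g x \<rho> h where y: "y = (g, x, \<rho>, h)" by (metis prod_cases4)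
        have "h \<in> (R - {\<rho>}) \<rightarrow> V" using that part unfolding y by (force simp: forests_def)
        moreover have "x \<in> V" "g \<in> forests (set us) A" using that unfolding y R_def by auto
        ultimately show ?thesis
          unfolding y prod.case
          by (intro mult_nonneg_nonneg P0 fnonneg less_imp_le[OF p] gA)
      qed
      fix t assume t: "t \<in> T"
      obtain \<rho> f where [simp]: "t = (\<rho>, f)" by force
      have "V - {\<rho>} = insert z (B \<union> A \<union> (R - {\<rho>}))"
        using rootA[of \<rho> f] rootR[of \<rho> f] t False part by auto
      moreover have "z \<notin> B \<union> A \<union> (R - {\<rho>})" using part zB by auto
      ultimately have "(\<Prod>v\<in>V - {\<rho>}. p (f v)) = p (f z) * (\<Prod>v\<in>B \<union> A \<union> (R - {\<rho>}). p (f v))"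
        using finA by simp
      also have "(\<Prod>v\<in>B \<union> A \<union> (R - {\<rho>}). p (f v)) =
          (\<Prod>v\<in>B. p (f v)) * (\<Prod>v\<in>A. p (f v)) * (\<Prod>v\<in>R - {\<rho>}. p (f v))"
        using finA part by (subst prod.union_disjoint; (subst prod.union_disjoint)?) auto
      finally show "rtree_weight p V t \<le> ?g (?\<phi> t)"
        using prodB t by (simp add: rtree_weight_def mult_ac)
    qed (use forestA zR in auto)
    also have "sum ?g ?U = (\<Sum>g\<in>forests (set us) A. P * (\<Prod>v\<in>A. p (g v))) *
        (\<Sum>(y, \<rho>, h)\<in>R \<times> ?rest. p y * (\<Prod>v\<in>R - {\<rho>}. p (h v)))"
      by (simp add: sum_product sum.cartesian_product case_prod_unfold)
    also have "(\<Sum>(y, \<rho>, h)\<in>R \<times> ?rest. p y * (\<Prod>v\<in>R - {\<rho>}. p (h v))) =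
        sum p R * (\<Sum>(\<rho>, h)\<in>?rest. \<Prod>v\<in>R - {\<rho>}. p (h v))"
      by (simp add: sum_product sum.cartesian_product case_prod_unfold)
    also have "(\<Sum>(\<rho>, h)\<in>?rest. \<Prod>v\<in>R - {\<rho>}. p (h v)) = (\<Sum>\<rho>\<in>R. forest_mass p {\<rho>} (R - {\<rho>}))"
      using finA by (subst sum.Sigma[symmetric]) (auto simp: forest_mass_def)
    also have "sum p R * (\<Sum>\<rho>\<in>R. forest_mass p {\<rho>} (R - {\<rho>})) = sum p R ^ card R"
      using finA False p part by (intro sum_tree_mass) auto
    finally show ?thesis by (simp add: fm sum_distrib_left mult_ac)
  qed
  then show ?thesis by (simp add: T_def R_def P_def k_def z_def)
qed

text \<open>
  Sum over the set of vertices that hang from the chain.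
\<close>

lemma chain_mass_le:
  assumes V: "finite V" and p: "\<And>i. i \<in> V \<Longrightarrow> p i > 0"
    and us: "distinct us" "set us \<subseteq> V" "us \<noteq> []"
  shows "(\<Sum>t\<in>{(\<rho>, f) \<in> light_ancestor_trees p V (length us - 1) a (hd us). ancestors f (length us - 1) (hd us) = us}.
      rtree_weight p V t) \<le> prod_list (map p (tl us)) * light_mass p (set us) (V - set us) a"
proof -
  let ?k = "length us - 1"
  let ?L = "{(\<rho>, f) \<in> light_ancestor_trees p V ?k a (hd us). ancestors f ?k (hd us) = us}"
  let ?As = "{A \<in> Pow (V - set us). sum p (set us) + sum p A < a}"
  let ?bush = "\<lambda>(\<rho>, f). subtree V f (last us) - set us"
  have st: "set us \<subseteq> subtree V f (last us)" "last us = (f ^^ ?k) (hd us)" if t: "(\<rho>, f) \<in> ?L" for \<rho> f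
  proof -
    interpret rtree V \<rho> f using t by (simp add: rtree_def light_ancestor_trees_def)
    have anc: "ancestors f ?k (hd us) = us" using t by simp
    show last: "last us = (f ^^ ?k) (hd us)" using last_ancestors[of f ?k "hd us"] unfolding anc .
    show "set us \<subseteq> subtree V f (last us)"
    proof
      fix u assume u: "u \<in> set us"
      then obtain i where i: "i < length us" "u = us ! i" by (auto simp: in_set_conv_nth)
      then have "u = (f ^^ i) (hd us)" using ancestors_nth[of i ?k f "hd us"] anc by auto
      moreover have "(f ^^ (?k - i)) ((f ^^ i) (hd us)) = (f ^^ ?k) (hd us)"
        using i by (simp add: funpow_add[symmetric, THEN fun_cong, unfolded o_apply])
      ultimately show "u \<in> subtree V f (last us)"
        using u us last by (auto simp: subtree_def)
    qed
  qed
  have "finite ?L" by (rule finite_subset[OF _ finite_rtrees[OF V]]) (auto simp: light_ancestor_trees_def)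
  have bush: "?bush ` ?L \<subseteq> ?As"
  proof (rule image_subsetI)
    fix t assume "t \<in> ?L"
    then obtain \<rho> f where tt: "t = (\<rho>, f)" and t: "(\<rho>, f) \<in> ?L" by (cases t) auto
    have S: "subtree V f (last us) \<subseteq> V" by (auto simp: subtree_def)
    then have "sum p (subtree V f (last us)) =
        sum p (subtree V f (last us) - set us) + sum p (set us)"
      using V st[OF t] by (intro sum.subset_diff) (auto intro: finite_subset)
    moreover have "sum p (subtree V f (last us)) < a" using t st[OF t] by (simp add: light_ancestor_trees_def)
    ultimately have "sum p (set us) + sum p (subtree V f (last us) - set us) < a" by linarith
    then show "?bush t \<in> ?As" unfolding tt using S by auto
  qed
  have "sum (rtree_weight p V) ?L = (\<Sum>A\<in>?As. sum (rtree_weight p V) {t \<in> ?L. ?bush t = A})"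
    by (rule sum.group[symmetric]) (use V \<open>finite ?L\<close> bush in auto)
  also have "\<dots> \<le> (\<Sum>A\<in>?As. prod_list (map p (tl us)) *
      (forest_mass p (set us) A * sum p (V - set us - A) ^ card (V - set us - A)))"
  proof (rule sum_mono)
    fix A assume A: "A \<in> ?As"
    let ?T = "{(\<rho>, f) \<in> rtrees V. ancestors f ?k (hd us) = us \<and>
        depth_ge (\<rho>, f) ?k (hd us) \<and> subtree V f (last us) = set us \<union> A}"
    have "{t \<in> ?L. ?bush t = A} \<subseteq> ?T"
      using st(1) by (auto simp: light_ancestor_trees_def)
    moreover have "finite ?T" by (rule finite_subset[OF _ finite_rtrees[OF V]]) auto
    moreover have "rtree_weight p V t \<ge> 0" if "t \<in> ?T" for t
      using that p by (intro rtree_weight_nonneg) auto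
    ultimately have "sum (rtree_weight p V) {t \<in> ?L. ?bush t = A} \<le> sum (rtree_weight p V) ?T"
      by (intro sum_mono2) auto
    also have "\<dots> \<le> prod_list (map p (tl us)) *
      (forest_mass p (set us) A * sum p (V - set us - A) ^ card (V - set us - A))"
      using A by (intro chain_subtree_mass V p us) auto
    finally show "sum (rtree_weight p V) {t \<in> ?L. ?bush t = A} \<le> \<dots>" .
  qed
  finally show ?thesis by (simp add: light_mass_def sum_distrib_left)
qed

section \<open>The expected mass below light ancestors\<close>

definition light_ancestor_mass :: "('a \<Rightarrow> real) \<Rightarrow> 'a set \<Rightarrow> nat \<Rightarrow> real \<Rightarrow> 'a \<times> ('a \<Rightarrow> 'a) \<Rightarrow> real" where
  "light_ancestor_mass p V k a t = sum p {v \<in> V. t \<in> light_ancestor_trees p V k a v}"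

text \<open>
  Classify the trees by the vertex \<open>v\<close> and its first \<open>k\<close> ancestors.  The weight \<open>p v\<close> supplies the factor
  for the start of the chain, so all its vertices enter symmetrically.
\<close>

lemma expected_light_ancestor_mass_le:
  assumes V: "finite V" and p: "\<And>i. i \<in> V \<Longrightarrow> p i > 0"
  shows "(\<Sum>t\<in>rtrees V. rtree_weight p V t * light_ancestor_mass p V k a t) \<le>
    (\<Sum>us\<in>{us. set us \<subseteq> V \<and> length us = Suc k \<and> distinct us}.
      prod_list (map p us) * light_mass p (set us) (V - set us) a)"
proof -
  let ?L = "{us. set us \<subseteq> V \<and> length us = Suc k \<and> distinct us}"
  let ?w = "rtree_weight p V"
  let ?anc = "\<lambda>v (\<rho> :: 'a, f). ancestors f k v"
  let ?b = "\<lambda>us. light_mass p (set us) (V - set us) a"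
  have finL: "finite ?L"
    by (rule finite_subset[OF _ finite_lists_length_eq[OF V, of "Suc k"]]) auto
  have fint: "finite (light_ancestor_trees p V k a v)" for v
    by (rule finite_subset[OF _ finite_rtrees[OF V]]) (auto simp: light_ancestor_trees_def)
  have sub: "light_ancestor_trees p V k a v \<subseteq> rtrees V" for v
    by (auto simp: light_ancestor_trees_def)
  have "(\<Sum>t\<in>rtrees V. ?w t * light_ancestor_mass p V k a t) =
      (\<Sum>t\<in>rtrees V. \<Sum>v\<in>V. if t \<in> light_ancestor_trees p V k a v then ?w t * p v else 0)"
    unfolding light_ancestor_mass_def sum_distrib_left
    by (rule sum.cong[OF refl], rule sum.inter_filter[OF V])
  also have "\<dots> = (\<Sum>v\<in>V. \<Sum>t\<in>rtrees V. if t \<in> light_ancestor_trees p V k a v then ?w t * p v else 0)"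
    by (rule sum.swap)
  also have "\<dots> = (\<Sum>v\<in>V. p v * sum ?w (light_ancestor_trees p V k a v))"
  proof (rule sum.cong[OF refl])
    fix v
    have "(\<Sum>t\<in>rtrees V. if t \<in> light_ancestor_trees p V k a v then ?w t * p v else 0) =
        (\<Sum>t\<in>rtrees V \<inter> light_ancestor_trees p V k a v. ?w t * p v)"
      using V by (simp add: sum.If_cases)
    also have "rtrees V \<inter> light_ancestor_trees p V k a v = light_ancestor_trees p V k a v" using sub by auto
    finally show "(\<Sum>t\<in>rtrees V. if t \<in> light_ancestor_trees p V k a v then ?w t * p v else 0) =
        p v * sum ?w (light_ancestor_trees p V k a v)"
      unfolding sum_distrib_right[symmetric] by (simp only: mult.commute)
  qed
  also have "\<dots> \<le> (\<Sum>v\<in>V. \<Sum>us\<in>{us \<in> ?L. hd us = v}. prod_list (map p us) * ?b us)"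
  proof (rule sum_mono)
    fix v assume v: "v \<in> V"
    let ?Lv = "{us \<in> ?L. hd us = v}"
    have anc: "?anc v ` light_ancestor_trees p V k a v \<subseteq> ?Lv"
    proof (rule image_subsetI)
      fix t assume "t \<in> light_ancestor_trees p V k a v"
      then obtain \<rho> f where t: "t = (\<rho>, f)" "(\<rho>, f) \<in> rtrees V" "depth_ge (\<rho>, f) k v"
        by (auto simp: light_ancestor_trees_def)
      interpret rtree V \<rho> f using t by (simp add: rtree_def)
      show "?anc v t \<in> ?Lv"
        using distinct_ancestors[OF v t(3)] v by (auto simp: t(1) ancestors_def simp del: upt_Suc)
           (simp add: upt_conv_Cons del: upt_Suc)
    qed
    have "sum ?w (light_ancestor_trees p V k a v) =
        (\<Sum>us\<in>?Lv. sum ?w {t \<in> light_ancestor_trees p V k a v. ?anc v t = us})"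
      by (rule sum.group[symmetric, OF fint _ anc]) (rule finite_subset[OF _ finL], auto)
    also have "\<dots> \<le> (\<Sum>us\<in>?Lv. prod_list (map p (tl us)) * ?b us)"
    proof (rule sum_mono)
      fix us assume us: "us \<in> ?Lv"
      then have "us \<noteq> []" by auto
      have "{t \<in> light_ancestor_trees p V k a v. ?anc v t = us} =
          {(\<rho>, f) \<in> light_ancestor_trees p V (length us - 1) a (hd us). ancestors f (length us - 1) (hd us) = us}"
        using us by auto
      then show "sum ?w {t \<in> light_ancestor_trees p V k a v. ?anc v t = us} \<le> prod_list (map p (tl us)) * ?b us"
        using chain_mass_le[where us = us and a = a, OF V p] us \<open>us \<noteq> []\<close> by simp
    qed
    finally have "p v * sum ?w (light_ancestor_trees p V k a v) \<le>
        p v * (\<Sum>us\<in>?Lv. prod_list (map p (tl us)) * ?b us)"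
      using p[OF v] by (intro mult_left_mono) auto
    also have "\<dots> = (\<Sum>us\<in>?Lv. prod_list (map p us) * ?b us)"
      unfolding sum_distrib_left
    proof (rule sum.cong[OF refl])
      fix us assume "us \<in> ?Lv"
      then obtain us' where "us = v # us'" by (cases us) auto
      then show "p v * (prod_list (map p (tl us)) * ?b us) = prod_list (map p us) * ?b us" by simp
    qed
    finally show "p v * sum ?w (light_ancestor_trees p V k a v) \<le> (\<Sum>us\<in>?Lv. prod_list (map p us) * ?b us)" .
  qed
  also have "\<dots> = (\<Sum>us\<in>?L. prod_list (map p us) * ?b us)"
  proof (rule sum.group[OF finL V])
    show "hd ` ?L \<subseteq> V"
    proof (rule image_subsetI)
      fix us assume "us \<in> ?L"
      then show "hd us \<in> V" by (cases us) auto
    qed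
  qed
  finally show ?thesis .
qed

lemma sum_prod_lists:
  fixes h :: "'a \<Rightarrow> real"
  assumes "finite V"
  shows "(\<Sum>us\<in>{us. set us \<subseteq> V \<and> length us = n}. prod_list (map h us)) = sum h V ^ n"
proof (induction n)
  case 0
  have "{us. set us \<subseteq> V \<and> length us = 0} = {[]}" by auto
  then show ?case by simp
next
  case (Suc n)
  have "(\<Sum>us\<in>{us. set us \<subseteq> V \<and> length us = Suc n}. prod_list (map h us)) =
      (\<Sum>(v, us)\<in>V \<times> {us. set us \<subseteq> V \<and> length us = n}. h v * prod_list (map h us))"
    by (rule sum.reindex_bij_witness[of _ "\<lambda>(v, us). v # us" "\<lambda>us. (hd us, tl us)"])
       (auto simp: length_Suc_conv)
  also have "\<dots> = sum h V * sum h V ^ n"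
    unfolding Suc.IH[symmetric] sum_product sum.cartesian_product ..
  finally show ?case by simp
qed

lemma sum_exp_le:
  fixes p :: "'a \<Rightarrow> real"
  assumes "finite V" "\<And>i. i \<in> V \<Longrightarrow> p i > 0" "sum p V = 1" "z \<ge> 0" "\<And>i. i \<in> V \<Longrightarrow> z * p i \<le> 1"
  shows "(\<Sum>i\<in>V. p i * exp (- (z * p i))) \<le> exp (- (z * (\<Sum>i\<in>V. (p i)\<^sup>2) / 2))"
proof -
  have "(\<Sum>i\<in>V. p i * exp (- (z * p i))) \<le> (\<Sum>i\<in>V. p i - z / 2 * (p i)\<^sup>2)"
  proof (rule sum_mono)
    fix i assume i: "i \<in> V"
    have u: "z * p i \<ge> 0" "z * p i \<le> 1" using assms(2,5)[OF i] assms(4) by auto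
    have "(z * p i)\<^sup>2 \<le> z * p i" using u by (simp add: power2_eq_square mult_left_le)
    then have "exp (- (z * p i)) \<le> 1 - z * p i / 2"
      using exp_minus_le_quadratic[OF u(1)] by linarith
    then have "p i * exp (- (z * p i)) \<le> p i * (1 - z * p i / 2)"
      using assms(2)[OF i] by (intro mult_left_mono) auto
    then show "p i * exp (- (z * p i)) \<le> p i - z / 2 * (p i)\<^sup>2"
      by (simp add: algebra_simps power2_eq_square)
  qed
  also have "\<dots> = 1 + - (z * (\<Sum>i\<in>V. (p i)\<^sup>2) / 2)"
    unfolding sum_subtractf assms(3) sum_distrib_left[symmetric] by simp
  also have "\<dots> \<le> exp (- (z * (\<Sum>i\<in>V. (p i)\<^sup>2) / 2))"
    by (rule exp_ge_add_one_self)
  finally show ?thesis .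
qed

lemma prod_list_exp:
  fixes p :: "'a \<Rightarrow> real"
  shows "prod_list (map p us) * exp (- (z * sum_list (map p us))) =
    prod_list (map (\<lambda>i. p i * exp (- (z * p i))) us)"
proof (induction us)
  case (Cons a us)
  have "exp (- (z * sum_list (map p (a # us)))) = exp (- (z * p a)) * exp (- (z * sum_list (map p us)))"
    by (simp add: distrib_left exp_add[symmetric])
  then show ?case unfolding list.map prod_list.Cons Cons.IH[symmetric] by (simp only: mult_ac)
qed simp

lemma prod_list_map_nonneg:
  fixes p :: "'a \<Rightarrow> real"
  shows "(\<And>i. i \<in> set us \<Longrightarrow> p i \<ge> 0) \<Longrightarrow> prod_list (map p us) \<ge> 0"
  by (induction us) auto

text \<open>
  After \<open>light_mass_le\<close> the summand is a product over the chain.  Dropping the requirement that the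
  chain be distinct, the sum becomes a power of \<open>\<Sum> p i exp (- z p i)\<close>.
\<close>

lemma expected_light_ancestor_mass_exp_le:
  assumes V: "finite V" and p: "\<And>i. i \<in> V \<Longrightarrow> p i > 0" and p1: "sum p V = 1"
    and \<theta>: "\<theta> \<ge> 0" and z: "z \<ge> 0" and a: "a < 1"
    and cond: "z\<^sup>2 * (\<Sum>i\<in>V. (p i)\<^sup>2) \<le> 2 * \<theta> * (1 - a) ^ 3"
    and zp: "\<And>i. i \<in> V \<Longrightarrow> z * p i \<le> 1"
  shows "(\<Sum>t\<in>rtrees V. rtree_weight p V t * light_ancestor_mass p V k a t) \<le>
    exp (\<theta> * a - real (Suc k) * z * (\<Sum>i\<in>V. (p i)\<^sup>2) / 2)"
proof -
  let ?L = "{us. set us \<subseteq> V \<and> length us = Suc k \<and> distinct us}"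
  let ?A = "{us. set us \<subseteq> V \<and> length us = Suc k}"
  let ?e = "\<lambda>i. p i * exp (- (z * p i))"
  have finA: "finite ?A" using finite_lists_length_eq[OF V] .
  have p0: "p i \<ge> 0" if "i \<in> V" for i using p[OF that] by simp
  have "(\<Sum>t\<in>rtrees V. rtree_weight p V t * light_ancestor_mass p V k a t) \<le>
      (\<Sum>us\<in>?L. prod_list (map p us) * light_mass p (set us) (V - set us) a)"
    by (rule expected_light_ancestor_mass_le[OF V p])
  also have "\<dots> \<le> (\<Sum>us\<in>?L. exp (\<theta> * a) * prod_list (map ?e us))"
  proof (rule sum_mono)
    fix us assume us: "us \<in> ?L"
    have tot: "1 = sum p (set us) + sum p (V - set us)"
      using sum.subset_diff[of "set us" V p] us V p1 by simp
    have "(\<Sum>i\<in>V - set us. (p i)\<^sup>2) \<le> (\<Sum>i\<in>V. (p i)\<^sup>2)" using V by (intro sum_mono2) auto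
    then have "z\<^sup>2 * (\<Sum>i\<in>V - set us. (p i)\<^sup>2) \<le> 2 * \<theta> * (1 - a) ^ 3"
      using cond by (meson mult_left_mono order_trans zero_le_power2)
    then have "light_mass p (set us) (V - set us) a \<le>
        1 ^ card (V - set us) * exp (\<theta> * a - z * sum p (set us) / 1)"
      using us V p \<theta> z a tot by (intro light_mass_le) auto
    also have "\<dots> = exp (\<theta> * a) * exp (- (z * sum_list (map p us)))"
      using us by (simp add: sum_list_distinct_conv_sum_set exp_diff exp_minus divide_inverse)
    finally have "prod_list (map p us) * light_mass p (set us) (V - set us) a \<le>
        prod_list (map p us) * (exp (\<theta> * a) * exp (- (z * sum_list (map p us))))"
      using us p0 by (intro mult_left_mono prod_list_map_nonneg) auto
    also have "\<dots> = exp (\<theta> * a) * (prod_list (map p us) * exp (- (z * sum_list (map p us))))"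
      by (simp only: mult_ac)
    finally show "prod_list (map p us) * light_mass p (set us) (V - set us) a \<le>
        exp (\<theta> * a) * prod_list (map ?e us)" unfolding prod_list_exp .
  qed
  also have "\<dots> = exp (\<theta> * a) * (\<Sum>us\<in>?L. prod_list (map ?e us))"
    by (rule sum_distrib_left[symmetric])
  also have "(\<Sum>us\<in>?L. prod_list (map ?e us)) \<le> (\<Sum>us\<in>?A. prod_list (map ?e us))"
    using finA p0 by (intro sum_mono2 prod_list_map_nonneg) auto
  also have "\<dots> = sum ?e V ^ Suc k" by (rule sum_prod_lists[OF V])
  also have "\<dots> \<le> exp (- (z * (\<Sum>i\<in>V. (p i)\<^sup>2) / 2)) ^ Suc k"
    using p0 by (intro power_mono sum_exp_le V p p1 z zp sum_nonneg) auto
  also have "\<dots> = exp (- (real (Suc k) * z * (\<Sum>i\<in>V. (p i)\<^sup>2) / 2))"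
    unfolding exp_of_nat_mult[symmetric] by (simp add: mult.assoc)
  finally show ?thesis
    by (simp add: mult_left_mono exp_add[symmetric])
qed

text \<open>
  This bound is meant for \<open>a > 1\<close>, when every subtree counts as light and the mass is that of all
  vertices of depth at least \<open>k\<close>.  It comes from the distinctness of the chain: its last \<open>m\<close> vertices
  avoid its first \<open>n\<close>, which have mass \<open>Q\<close>, say, and this costs \<open>(1 - Q) ^ m \<le> exp (- y Q)\<close>.
\<close>

lemma expected_deep_mass_exp_le:
  assumes V: "finite V" and p: "\<And>i. i \<in> V \<Longrightarrow> p i > 0" and p1: "sum p V = 1"
    and y: "y \<ge> 0" "y \<le> real m" and n: "Suc k = n + m"
    and zp: "\<And>i. i \<in> V \<Longrightarrow> y * p i \<le> 1"
  shows "(\<Sum>t\<in>rtrees V. rtree_weight p V t * light_ancestor_mass p V k a t) \<le>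
    exp (- (real n * y * (\<Sum>i\<in>V. (p i)\<^sup>2) / 2))"
proof -
  let ?L = "{us. set us \<subseteq> V \<and> length us = Suc k \<and> distinct us}"
  let ?A = "{us. set us \<subseteq> V \<and> length us = n}"
  let ?D = "{us \<in> ?A. distinct us}"
  let ?B = "\<lambda>us. {ws. set ws \<subseteq> V - set us \<and> length ws = m}"
  let ?e = "\<lambda>i. p i * exp (- (y * p i))"
  have finA: "finite ?A" using finite_lists_length_eq[OF V] .
  have finD: "finite ?D" by (rule finite_subset[OF _ finA]) auto
  have finB: "finite (?B us)" for us using finite_lists_length_eq[of "V - set us"] V by simp
  have p0: "p i \<ge> 0" if "i \<in> V" for i using p[OF that] by simp
  have "(\<Sum>t\<in>rtrees V. rtree_weight p V t * light_ancestor_mass p V k a t) \<le>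
      (\<Sum>us\<in>?L. prod_list (map p us) * light_mass p (set us) (V - set us) a)"
    by (rule expected_light_ancestor_mass_le[OF V p])
  also have "\<dots> \<le> (\<Sum>us\<in>?L. prod_list (map p us))"
  proof (rule sum_mono)
    fix us assume us: "us \<in> ?L"
    have tot: "1 = sum p (set us) + sum p (V - set us)"
      using sum.subset_diff[of "set us" V p] us V p1 by simp
    have "light_mass p (set us) (V - set us) a \<le>
        1 ^ card (V - set us) * exp (0 * a - 0 * sum p (set us) / 1)"
      using us V p tot by (intro light_mass_le) auto
    then have "light_mass p (set us) (V - set us) a \<le> 1" by simp
    then show "prod_list (map p us) * light_mass p (set us) (V - set us) a \<le> prod_list (map p us)"
      using us p0 mult_left_mono[of _ 1 "prod_list (map p us)"]
      by (auto intro!: prod_list_map_nonneg)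
  qed
  also have "\<dots> \<le> (\<Sum>(us, ws)\<in>Sigma ?D ?B. prod_list (map p us) * prod_list (map p ws))"
  proof (rule sum_le_inj[where \<phi> = "\<lambda>us. (take n us, drop n us)"])
    show "inj_on (\<lambda>us. (take n us, drop n us)) ?L"
      by (rule inj_onI) (metis append_take_drop_id prod.inject)
    show "(\<lambda>us. (take n us, drop n us)) ` ?L \<subseteq> Sigma ?D ?B"
    proof (rule image_subsetI)
      fix us assume us: "us \<in> ?L"
      then have "set (take n us) \<inter> set (drop n us) = {}" by (simp add: set_take_disj_set_drop_if_distinct)
      then show "(take n us, drop n us) \<in> Sigma ?D ?B"
        using us n by (auto dest: in_set_takeD in_set_dropD)
    qed
    show "finite (Sigma ?D ?B)" using finD finB by auto
    fix x assume "x \<in> Sigma ?D ?B"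
    then show "0 \<le> (case x of (us, ws) \<Rightarrow> prod_list (map p us) * prod_list (map p ws))"
      using p0 by (auto intro!: mult_nonneg_nonneg prod_list_map_nonneg)
  next
    fix us
    have "prod_list (map p us) = prod_list (map p (take n us @ drop n us))" by simp
    then show "prod_list (map p us) \<le> (case (take n us, drop n us) of (us, ws) \<Rightarrow>
      prod_list (map p us) * prod_list (map p ws))"
      unfolding map_append prod_list.append by simp
  qed
  also have "\<dots> = (\<Sum>us\<in>?D. prod_list (map p us) * (\<Sum>ws\<in>?B us. prod_list (map p ws)))"
    using finD finB by (subst sum.Sigma[symmetric]) (auto simp: sum_distrib_left)
  also have "\<dots> \<le> (\<Sum>us\<in>?D. prod_list (map ?e us))"
  proof (rule sum_mono)
    fix us assume us: "us \<in> ?D"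
    let ?q = "sum p (set us)"
    have fu: "finite (V - set us)" using V by simp
    have qV: "sum p (V - set us) = 1 - ?q"
      using sum.subset_diff[of "set us" V p] us V p1 by simp
    have q1: "1 - ?q \<ge> 0" unfolding qV[symmetric] using p0 by (intro sum_nonneg) auto
    have q0: "?q \<ge> 0" using us p0 by (intro sum_nonneg) auto
    have "(\<Sum>ws\<in>?B us. prod_list (map p ws)) = (1 - ?q) ^ m"
      unfolding sum_prod_lists[OF fu] qV ..
    also have "\<dots> \<le> exp (- ?q) ^ m"
      using q1 exp_ge_add_one_self[of "- ?q"] by (intro power_mono) auto
    also have "\<dots> = exp (- (real m * ?q))" by (simp add: exp_of_nat_mult[symmetric])
    also have "\<dots> \<le> exp (- (y * sum_list (map p us)))"
      using us y(2) q0 by (simp add: sum_list_distinct_conv_sum_set mult_right_mono)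
    finally show "prod_list (map p us) * (\<Sum>ws\<in>?B us. prod_list (map p ws)) \<le> prod_list (map ?e us)"
      unfolding prod_list_exp[symmetric] using us p0 by (intro mult_left_mono prod_list_map_nonneg) auto
  qed
  also have "\<dots> \<le> (\<Sum>us\<in>?A. prod_list (map ?e us))"
    using finA p0 by (intro sum_mono2 prod_list_map_nonneg) auto
  also have "\<dots> = sum ?e V ^ n" by (rule sum_prod_lists[OF V])
  also have "\<dots> \<le> exp (- (y * (\<Sum>i\<in>V. (p i)\<^sup>2) / 2)) ^ n"
    using p0 by (intro power_mono sum_exp_le V p p1 y zp sum_nonneg) auto
  also have "\<dots> = exp (- (real n * y * (\<Sum>i\<in>V. (p i)\<^sup>2) / 2))"
    unfolding exp_of_nat_mult[symmetric] by (simp add: mult.assoc)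
  finally show ?thesis .
qed

section \<open>Chaining along the path from a depth_ge vertex to the root\<close>

lemma depth_ge_mono: "depth_ge t k v \<Longrightarrow> k' \<le> k \<Longrightarrow> depth_ge t k' v"
  by (auto simp: depth_ge_def split: prod.splits)

text \<open>
  A light ancestor of \<open>w\<close> at distance \<open>k\<close> makes every descendant \<open>v\<close> of \<open>w\<close> have one too: the \<open>k\<close>-th
  ancestor of \<open>v\<close> lies below the \<open>k\<close>-th ancestor of \<open>w\<close>.
\<close>

lemma subtree_le_light_ancestor_mass:
  assumes V: "finite V" and p: "\<And>i. i \<in> V \<Longrightarrow> p i > 0" and t: "(\<rho>, f) \<in> rtrees V"
    and w: "w \<in> V" "depth_ge (\<rho>, f) k w" "sum p (subtree V f ((f ^^ k) w)) < a"
  shows "sum p (subtree V f w) \<le> light_ancestor_mass p V k a (\<rho>, f)"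
  unfolding light_ancestor_mass_def
proof (rule sum_mono2)
  interpret rtree V \<rho> f using t by (simp add: rtree_def)
  show "subtree V f w \<subseteq> {v \<in> V. (\<rho>, f) \<in> light_ancestor_trees p V k a v}"
  proof
    fix v assume "v \<in> subtree V f w"
    then obtain n where v: "v \<in> V" "(f ^^ n) v = w" by (auto simp: subtree_def)
    have comm: "(f ^^ n) ((f ^^ i) u) = (f ^^ i) ((f ^^ n) u)" for i u
      by (metis add.commute comp_apply funpow_add)
    have "depth_ge (\<rho>, f) k v"
      unfolding depth_ge_def prod.case
    proof (intro allI impI notI)
      fix i assume "i < k" "(f ^^ i) v = \<rho>"
      then have "(f ^^ i) w = \<rho>" using comm[of i v] v by simp
      then show False using w(2) \<open>i < k\<close> by (auto simp: depth_ge_def)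
    qed
    moreover have "subtree V f ((f ^^ k) v) \<subseteq> subtree V f ((f ^^ k) w)"
    proof
      fix u assume "u \<in> subtree V f ((f ^^ k) v)"
      then obtain l where u: "u \<in> V" "(f ^^ l) u = (f ^^ k) v" by (auto simp: subtree_def)
      then have "(f ^^ (n + l)) u = (f ^^ k) w" using comm[of k v] v by (simp add: funpow_add)
      then show "u \<in> subtree V f ((f ^^ k) w)" using u unfolding subtree_def by blast
    qed
    then have "sum p (subtree V f ((f ^^ k) v)) \<le> sum p (subtree V f ((f ^^ k) w))"
      using p subtree_subset finite_subset[OF subtree_subset V]
      by (intro sum_mono2) (auto simp: less_imp_le subset_iff)
    ultimately show "v \<in> {v \<in> V. (\<rho>, f) \<in> light_ancestor_trees p V k a v}"
      using v t w by (auto simp: light_ancestor_trees_def)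
  qed
qed (use V p in \<open>auto simp: less_imp_le\<close>)

text \<open>
  Climb from \<open>w\<close> by \<open>k J\<close> steps, then \<open>k (J - 1)\<close>, and so on.  If no step met a subtree that is too
  light, the last one would end at a subtree of mass at least \<open>a 0\<close>, which exceeds the total mass.
\<close>

lemma light_ancestor_chaining:
  assumes V: "finite V" and p: "\<And>i. i \<in> V \<Longrightarrow> p i > 0" and t: "(\<rho>, f) \<in> rtrees V"
    and a0: "sum p V < a 0"
    and w: "w \<in> V" "depth_ge (\<rho>, f) (\<Sum>j\<le>J. k j) w" "a (Suc J) \<le> sum p (subtree V f w)"
  shows "\<exists>j\<le>J. a (Suc j) \<le> light_ancestor_mass p V (k j) (a j) (\<rho>, f)"
  using w
proof (induction J arbitrary: w)
  case (0 w)
  interpret rtree V \<rho> f using t by (simp add: rtree_def)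
  have "sum p (subtree V f ((f ^^ k 0) w)) \<le> sum p V"
    using V p subtree_subset by (intro sum_mono2) (auto simp: less_imp_le)
  then have "sum p (subtree V f w) \<le> light_ancestor_mass p V (k 0) (a 0) (\<rho>, f)"
    using 0 a0 by (intro subtree_le_light_ancestor_mass V p t) auto
  then show ?case using 0 by auto
next
  case (Suc J w)
  interpret rtree V \<rho> f using t by (simp add: rtree_def)
  let ?k = "k (Suc J)"
  let ?z = "(f ^^ ?k) w"
  show ?case
  proof (cases "sum p (subtree V f ?z) < a (Suc J)")
    case True
    have "sum p (subtree V f w) \<le> light_ancestor_mass p V ?k (a (Suc J)) (\<rho>, f)"
      using Suc.prems depth_ge_mono[of "(\<rho>, f)" _ w ?k] True
      by (intro subtree_le_light_ancestor_mass V p t) auto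
    then show ?thesis using Suc.prems by (intro exI[of _ "Suc J"]) auto
  next
    case False
    have "depth_ge (\<rho>, f) (\<Sum>j\<le>J. k j) ?z"
      unfolding depth_ge_def prod.case
    proof (intro allI impI)
      fix i assume "i < (\<Sum>j\<le>J. k j)"
      then have "(f ^^ (i + ?k)) w \<noteq> \<rho>" using Suc.prems(2) by (auto simp: depth_ge_def)
      then show "(f ^^ i) ?z \<noteq> \<rho>" by (simp add: funpow_add)
    qed
    then obtain j where "j \<le> J" "a (Suc j) \<le> light_ancestor_mass p V (k j) (a j) (\<rho>, f)"
      using Suc.IH[of ?z] False Suc.prems by auto
    then show ?thesis by (intro exI[of _ j]) auto
  qed
qed

lemma markov_sum:
  fixes w X :: "'b \<Rightarrow> real"
  assumes "finite T" "\<And>t. t \<in> T \<Longrightarrow> w t \<ge> 0" "\<And>t. t \<in> T \<Longrightarrow> X t \<ge> 0" "b > 0"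
  shows "sum w {t \<in> T. b \<le> X t} \<le> (\<Sum>t\<in>T. w t * X t) / b"
proof -
  have "sum w {t \<in> T. b \<le> X t} \<le> (\<Sum>t\<in>{t \<in> T. b \<le> X t}. w t * X t / b)"
  proof (rule sum_mono)
    fix t assume t: "t \<in> {t \<in> T. b \<le> X t}"
    then have "w t * 1 \<le> w t * (X t / b)" using assms by (intro mult_left_mono) auto
    then show "w t \<le> w t * X t / b" by simp
  qed
  also have "\<dots> \<le> (\<Sum>t\<in>T. w t * X t / b)" using assms by (intro sum_mono2) auto
  finally show ?thesis by (simp add: sum_divide_distrib)
qed

lemma sum_UN_le:
  fixes w :: "'b \<Rightarrow> real"
  assumes "finite I" "\<And>i. i \<in> I \<Longrightarrow> finite (A i)" "\<And>i t. i \<in> I \<Longrightarrow> t \<in> A i \<Longrightarrow> w t \<ge> 0"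
  shows "sum w (\<Union>i\<in>I. A i) \<le> (\<Sum>i\<in>I. sum w (A i))"
  using assms
proof (induction I rule: finite_induct)
  case (insert i I)
  have "sum w (A i \<union> (\<Union>i\<in>I. A i)) = sum w (A i) + sum w ((\<Union>i\<in>I. A i) - A i)"
    using insert by (subst sum.union_disjoint[symmetric]) auto
  also have "sum w ((\<Union>i\<in>I. A i) - A i) \<le> sum w (\<Union>i\<in>I. A i)"
    using insert by (intro sum_mono2) auto
  also have "\<dots> \<le> (\<Sum>i\<in>I. sum w (A i))" using insert.prems by (intro insert.IH) auto
  finally show ?case using insert.hyps by simp
qed simp

lemma exp_minus_le_fact:
  fixes y :: real
  assumes "y > 0"
  shows "exp (- y) \<le> fact N / y ^ N"
proof -
  have "y ^ N / fact N \<le> exp y"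
  proof -
    have "(\<Sum>n\<in>{N}. y ^ n /\<^sub>R fact n) \<le> (\<Sum>n. y ^ n /\<^sub>R fact n)"
      using assms by (intro sum_le_suminf summable_exp_generic) (auto simp: divide_inverse)
    then show ?thesis by (simp add: exp_def divide_inverse mult.commute)
  qed
  then have "inverse (exp y) \<le> inverse (y ^ N / fact N)" using assms by (intro le_imp_inverse_le) auto
  then show ?thesis by (simp add: exp_minus field_simps)
qed

lemma ex_power_16:
  fixes y :: real
  assumes "1 \<le> y"
  shows "\<exists>J. 16 ^ J \<le> y \<and> y < 16 ^ Suc J"
proof -
  obtain n where n: "y < 16 ^ n" using real_arch_pow[of 16 y] by auto
  define m where "m = (LEAST n. y < 16 ^ n)"
  have m: "y < 16 ^ m" unfolding m_def using n by (rule LeastI)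
  then obtain J where J: "m = Suc J" using assms by (cases m) auto
  have "\<not> y < 16 ^ J" using not_less_Least[of J "\<lambda>n. y < 16 ^ n"] J unfolding m_def by simp
  then show ?thesis using m J by (intro exI[of _ J]) auto
qed

lemma sum_half_powers: "(\<Sum>j\<le>J. (1 / 2) ^ j) \<le> (2 :: real)"
  using geometric_sum[of "1/2 :: real" "Suc J"] by (simp add: lessThan_Suc_atMost)

section \<open>The height of a random parent map\<close>

text \<open>
  The lower bound \<open>s powr r\<^sub>0\<close> on the weights enters only through the last link of the chain, where the
  mass of a subtree is bounded below by the weight of a single vertex.
\<close>

theorem rtree_height_tail:
  fixes r r\<^sub>0 :: real
  assumes r: "r > 0"
  shows "\<exists>K > 0. \<forall>(V :: 'a set) p s x N.
    finite V \<longrightarrow> (\<forall>i\<in>V. p i > 0) \<longrightarrow> sum p V = 1 \<longrightarrow>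
    s > 0 \<longrightarrow> s \<le> 1 / 4 \<longrightarrow> s\<^sup>2 = (\<Sum>i\<in>V. (p i)\<^sup>2) \<longrightarrow>
    (\<forall>i\<in>V. p i \<le> s * sqrt s) \<longrightarrow> (\<forall>i\<in>V. s powr r\<^sub>0 \<le> p i) \<longrightarrow>
    x \<ge> 1 \<longrightarrow> x / s \<le> real N \<longrightarrow>
    sum (rtree_weight p V) {t \<in> rtrees V. \<exists>v\<in>V. depth_ge t N v} \<le> K / x powr r"
proof -
  \<comment> \<open>The links lose at most a factor \<open>16 ^ (q * Suc j)\<close>; the exponent \<open>M\<close> is large enough to turn
    this into a geometric series and to leave \<open>x powr r\<close> in the denominator.\<close>
  define q where "q = Suc (nat \<lceil>r\<^sub>0\<rceil>)"
  define M where "M = 4 * q + 1 + nat \<lceil>r\<rceil>"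
  define c where "c = 16 ^ q * exp 1 * fact M * (128 :: real) ^ M"
  have c: "c > 0" by (simp add: c_def)
  have main: "sum (rtree_weight p V) {t \<in> rtrees V. \<exists>v\<in>V. depth_ge t N v} \<le> 2 * c / x powr r"
    if V: "finite V" and p': "\<forall>i\<in>V. p i > 0" and p1: "sum p V = 1"
      and s: "s > 0" "s \<le> 1 / 4" and sq: "s\<^sup>2 = (\<Sum>i\<in>V. (p i)\<^sup>2)"
      and pmax: "\<forall>i\<in>V. p i \<le> s * sqrt s" and pmin: "\<forall>i\<in>V. s powr r\<^sub>0 \<le> p i"
      and x: "x \<ge> 1" and N: "x / s \<le> real N"
    for V :: "'a set" and p s x N
  proof -
    have p: "\<And>i. i \<in> V \<Longrightarrow> p i > 0" using p' by blast
    let ?w = "rtree_weight p V"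
    have w0: "t \<in> rtrees V \<Longrightarrow> ?w t \<ge> 0" for t using rtree_weight_nonneg p by blast
    obtain J where J: "16 ^ J \<le> 1 / s" "1 / s < 16 ^ Suc J"
      using ex_power_16[of "1 / s"] s by (auto simp: field_simps)
    \<comment> \<open>Allowances \<open>k j\<close> with sum at most \<open>x / s\<close>, and the masses \<open>a j\<close> that separate them; the value
      \<open>2\<close> exceeds the total mass.\<close>
    define k where "k j = nat \<lfloor>x / (2 ^ Suc j * s)\<rfloor>" for j
    define a :: "nat \<Rightarrow> real"
      where "a j = (if j = 0 then 2 else if j \<le> J then (1 / 16) ^ j else s powr r\<^sub>0)" for j
    let ?X = "\<lambda>j. light_ancestor_mass p V (k j) (a j)"
    have X0: "?X j t \<ge> 0" for j t
      unfolding light_ancestor_mass_def using p by (intro sum_nonneg) (auto simp: less_imp_le)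
    have kN: "(\<Sum>j\<le>J. k j) \<le> N"
    proof -
      have "real (\<Sum>j\<le>J. k j) \<le> (\<Sum>j\<le>J. x / (2 * s) * (1 / 2) ^ j)"
        unfolding of_nat_sum
      proof (rule sum_mono)
        fix j
        have "x / (2 ^ Suc j * s) \<ge> 0" using x s by simp
        then have "real (k j) \<le> x / (2 ^ Suc j * s)" unfolding k_def by (rule of_nat_floor)
        then show "real (k j) \<le> x / (2 * s) * (1 / 2) ^ j" by (simp add: power_divide mult_ac)
      qed
      also have "\<dots> = x / (2 * s) * (\<Sum>j\<le>J. (1 / 2) ^ j)" by (rule sum_distrib_left[symmetric])
      also have "\<dots> \<le> x / (2 * s) * 2" using x s by (intro mult_left_mono sum_half_powers) auto
      also have "\<dots> \<le> real N" using N by simp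
      finally show ?thesis by linarith
    qed
    have k_ge: "real (Suc (k j)) \<ge> x / (2 ^ Suc j * s)" for j
      unfolding k_def by linarith
    \<comment> \<open>Each link: the expected mass of the vertices that exceed their \<open>j\<close>-th allowance.\<close>
    have link: "(\<Sum>t\<in>rtrees V. ?w t * ?X j t) \<le> exp (1 - x * 2 ^ j / 128)" if "j \<le> J" for j
    proof (cases "j = 0")
      case True
      \<comment> \<open>No light subtrees in the first link: compare the two halves of the chain instead.\<close>
      define n where "n = Suc (k 0) div 2"
      define m where "m = Suc (k 0) - n"
      have k0: "real (Suc (k 0)) \<ge> x / (2 * s)" using k_ge[of 0] by simp
      have nm: "2 * n \<le> Suc (k 0)" "Suc (k 0) \<le> 2 * n + 1" "Suc (k 0) = n + m" "n \<le> m"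
        unfolding n_def m_def by auto
      have xs: "x / s \<ge> 4" "x / s \<ge> 1 / s" using x s by (auto simp: field_simps)
      have n: "real n \<ge> x / (8 * s)" using k0 nm(2) xs by (simp add: field_simps)
      have "real m \<ge> x / (4 * s)" using k0 nm by simp
      moreover have "x / (4 * s) \<ge> 1 / (4 * s)" using x s by (intro divide_right_mono) auto
      ultimately have m: "1 / (4 * s) \<le> real m" by linarith
      have "1 / (4 * s) * p i \<le> 1" if "i \<in> V" for i
      proof -
        have "p i \<le> s * sqrt s" using pmax that by blast
        also have "\<dots> \<le> s * 1" using s by (intro mult_left_mono) auto
        finally show ?thesis using s p[OF that] by (simp add: field_simps)
      qed
      then have "(\<Sum>t\<in>rtrees V. ?w t * ?X 0 t) \<le> exp (- (real n * (1 / (4 * s)) * s\<^sup>2 / 2))"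
        unfolding sq using s m nm by (intro expected_deep_mass_exp_le V p p1) auto
      also have "\<dots> \<le> exp (1 - x / 128)"
      proof -
        have "x / (8 * s) * (s / 8) \<le> real n * (s / 8)" using n s by (intro mult_right_mono) auto
        moreover have "x / (8 * s) * (s / 8) = x / 64" using s by simp
        moreover have "real n * (1 / (4 * s)) * s\<^sup>2 / 2 = real n * (s / 8)"
          using s by (simp add: power2_eq_square field_simps)
        ultimately show ?thesis using x by simp
      qed
      finally show ?thesis using True by simp
    next
      case False
      \<comment> \<open>With this \<open>z\<close> and \<open>\<theta> = 16 ^ j\<close> the correction \<open>\<theta> * a j\<close> is \<open>1\<close>.\<close>
      define z where "z = 4 ^ j / s"
      have aj: "a j = (1 / 16) ^ j" using False that by (simp add: a_def)
      have aj16: "a j \<le> 1 / 16"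
        unfolding aj using False power_decreasing[of 1 j "1 / 16 :: real"] by simp
      have zz: "z\<^sup>2 * s\<^sup>2 = 16 ^ j"
      proof -
        have "z\<^sup>2 * s\<^sup>2 = (4 ^ j)\<^sup>2" using s by (simp add: z_def power_divide)
        also have "\<dots> = (4\<^sup>2) ^ j" by (simp only: power_mult[symmetric] mult.commute)
        finally show ?thesis by simp
      qed
      have "(15 / 16) ^ 3 \<le> (1 - a j) ^ 3" using aj16 by (intro power_mono) auto
      then have "(1 / 2 :: real) \<le> (1 - a j) ^ 3" by (simp add: power3_eq_cube)
      then have "16 ^ j * 1 \<le> 16 ^ j * (2 * (1 - a j) ^ 3)" by (intro mult_left_mono) auto
      then have cond: "z\<^sup>2 * (\<Sum>i\<in>V. (p i)\<^sup>2) \<le> 2 * 16 ^ j * (1 - a j) ^ 3"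
        unfolding sq[symmetric] zz by simp
      \<comment> \<open>This is where \<open>16 ^ j \<le> 1 / s\<close> and the upper bound on the weights are needed.\<close>
      have zp: "z * p i \<le> 1" if "i \<in> V" for i
      proof -
        have "(4 ^ j * sqrt s)\<^sup>2 = 16 ^ j * s"
          using s power_mult[of "4 :: real" j 2] power_mult[of "4 :: real" 2 j]
          by (simp add: power_mult_distrib mult.commute)
        also have "\<dots> \<le> 16 ^ J * s" using \<open>j \<le> J\<close> s by (intro mult_right_mono power_increasing) auto
        also have "\<dots> \<le> 1" using J(1) s by (simp add: field_simps)
        finally have "4 ^ j * sqrt s \<le> 1" by (rule power2_le_imp_le[of _ 1, simplified])
        moreover have "z * p i \<le> z * (s * sqrt s)"
          using pmax that s by (intro mult_left_mono) (auto simp: z_def)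
        moreover have "z * (s * sqrt s) = 4 ^ j * sqrt s" using s by (simp add: z_def)
        ultimately show ?thesis by linarith
      qed
      have "(\<Sum>t\<in>rtrees V. ?w t * ?X j t) \<le> exp (16 ^ j * a j - real (Suc (k j)) * z * s\<^sup>2 / 2)"
        unfolding sq using s aj16 cond zp by (intro expected_light_ancestor_mass_exp_le V p p1) (auto simp: z_def)
      also have "16 ^ j * a j = 1" unfolding aj by (simp add: power_mult_distrib[symmetric])
      also have "exp (1 - real (Suc (k j)) * z * s\<^sup>2 / 2) \<le> exp (1 - x * 2 ^ j / 128)"
      proof -
        have "x * 2 ^ j / 4 = x / (2 ^ Suc j * s) * (4 ^ j * s / 2)"
        proof -
          have "(4 :: real) ^ j = 2 ^ j * 2 ^ j" by (simp add: power_mult_distrib[symmetric])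
          then show ?thesis using s by (simp add: field_simps)
        qed
        also have "\<dots> \<le> real (Suc (k j)) * (4 ^ j * s / 2)"
          using k_ge[of j] s by (intro mult_right_mono) auto
        also have "\<dots> = real (Suc (k j)) * z * s\<^sup>2 / 2"
          using s by (simp add: z_def power2_eq_square)
        finally have "x * 2 ^ j / 4 \<le> real (Suc (k j)) * z * s\<^sup>2 / 2" .
        moreover have "x * 2 ^ j / 128 \<le> x * 2 ^ j / 4" using x by simp
        ultimately show ?thesis by simp
      qed
      finally show ?thesis .
    qed
    have a_inv: "1 / a (Suc j) \<le> 16 ^ (q * Suc j)" and a_pos: "a (Suc j) > 0" if "j \<le> J" for j
    proof -
      have "1 / a (Suc j) \<le> 16 ^ (q * Suc j) \<and> a (Suc j) > 0"
      proof (cases "j = J")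
        case False
        then have "a (Suc j) = (1 / 16) ^ Suc j" using that by (simp add: a_def)
        moreover have "(16 :: real) ^ Suc j \<le> 16 ^ (q * Suc j)"
          by (intro power_increasing) (auto simp: q_def)
        ultimately show ?thesis by (simp add: power_divide)
      next
        case True
        then have "1 / a (Suc j) = (1 / s) powr r\<^sub>0" using s by (simp add: a_def powr_divide)
        also have "\<dots> \<le> (1 / s) powr real q"
        proof (rule powr_mono)
          show "r\<^sub>0 \<le> real q" unfolding q_def by linarith
          show "1 \<le> 1 / s" using s by simp
        qed
        also have "\<dots> = (1 / s) ^ q" using s by (simp add: powr_realpow)
        also have "\<dots> \<le> (16 ^ Suc J) ^ q" using J s by (intro power_mono) auto
        also have "\<dots> = 16 ^ (q * Suc j)" unfolding power_mult[symmetric] True by (simp only: mult.commute)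
        finally show ?thesis using True s by (simp add: a_def)
      qed
      then show "1 / a (Suc j) \<le> 16 ^ (q * Suc j)" "a (Suc j) > 0" by auto
    qed
    have summand: "sum ?w {t \<in> rtrees V. a (Suc j) \<le> ?X j t} \<le> c / x powr r * (1 / 2) ^ j" if "j \<le> J" for j
    proof -
      have "sum ?w {t \<in> rtrees V. a (Suc j) \<le> ?X j t} \<le> (\<Sum>t\<in>rtrees V. ?w t * ?X j t) / a (Suc j)"
        using V w0 X0 a_pos[OF that] by (intro markov_sum) auto
      also have "\<dots> \<le> exp (1 - x * 2 ^ j / 128) * (1 / a (Suc j))"
        using link[OF that] a_pos[OF that] by (simp add: divide_right_mono)
      also have "\<dots> \<le> exp (1 - x * 2 ^ j / 128) * 16 ^ (q * Suc j)"
        using a_inv[OF that] by (intro mult_left_mono) auto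
      also have "\<dots> = 16 ^ (q * Suc j) * exp 1 * exp (- (x * 2 ^ j / 128))"
        by (simp add: exp_add[symmetric])
      also have "\<dots> \<le> 16 ^ (q * Suc j) * exp 1 * (fact M / (x * 2 ^ j / 128) ^ M)"
        using x by (intro mult_left_mono exp_minus_le_fact) auto
      also have "\<dots> = c / x ^ M * (16 ^ (q * j) / (2 ^ j) ^ M)"
        by (simp add: c_def power_add power_mult_distrib power_divide)
      also have "\<dots> \<le> c / x powr r * (1 / 2) ^ j"
      proof (intro mult_mono)
        have "x powr r \<le> x powr real M"
          using x unfolding M_def by (intro powr_mono) linarith+
        also have "\<dots> = x ^ M" using x by (simp add: powr_realpow)
        finally show "c / x ^ M \<le> c / x powr r" using x c by (intro divide_left_mono) auto
        have "(16 :: real) ^ (q * j) = 2 ^ (4 * (q * j))" by (simp add: power_mult)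
        moreover have "(2 :: real) ^ (4 * (q * j)) * 2 ^ j \<le> 2 ^ (j * M)"
          unfolding power_add[symmetric]
          by (intro power_increasing) (auto simp: M_def algebra_simps)
        ultimately show "16 ^ (q * j) / (2 ^ j) ^ M \<le> (1 / 2 :: real) ^ j"
          unfolding power_mult[of 2 j M, symmetric] by (simp add: power_divide field_simps)
      qed (use c in auto)
      finally show ?thesis .
    qed
    have "{t \<in> rtrees V. \<exists>v\<in>V. depth_ge t N v} \<subseteq> (\<Union>j\<in>{..J}. {t \<in> rtrees V. a (Suc j) \<le> ?X j t})"
    proof
      fix t assume "t \<in> {t \<in> rtrees V. \<exists>v\<in>V. depth_ge t N v}"
      then obtain \<rho> f v where t: "t = (\<rho>, f)" "(\<rho>, f) \<in> rtrees V" and v: "v \<in> V" "depth_ge (\<rho>, f) N v"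
        by (cases t) auto
      interpret rtree V \<rho> f using t by (simp add: rtree_def)
      have "a (Suc J) = s powr r\<^sub>0" by (simp add: a_def)
      also have "\<dots> \<le> sum p {v}" using pmin v by simp
      also have "\<dots> \<le> sum p (subtree V f v)"
        using subtree_self[OF v(1)] p finite_subset[OF subtree_subset V] subtree_subset[of v]
        by (intro sum_mono2) (auto simp: less_imp_le subset_iff)
      finally have "\<exists>j\<le>J. a (Suc j) \<le> ?X j (\<rho>, f)"
        using v depth_ge_mono[OF v(2) kN] p1
        by (intro light_ancestor_chaining V p t(2)) (auto simp: a_def)
      then show "t \<in> (\<Union>j\<in>{..J}. {t \<in> rtrees V. a (Suc j) \<le> ?X j t})" using t by auto
    qed
    then have "sum ?w {t \<in> rtrees V. \<exists>v\<in>V. depth_ge t N v} \<le>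
        sum ?w (\<Union>j\<in>{..J}. {t \<in> rtrees V. a (Suc j) \<le> ?X j t})"
      using V w0 by (intro sum_mono2) auto
    also have "\<dots> \<le> (\<Sum>j\<le>J. sum ?w {t \<in> rtrees V. a (Suc j) \<le> ?X j t})"
      using V w0 by (intro sum_UN_le) auto
    also have "\<dots> \<le> (\<Sum>j\<le>J. c / x powr r * (1 / 2) ^ j)"
      using summand by (intro sum_mono) auto
    also have "\<dots> = c / x powr r * (\<Sum>j\<le>J. (1 / 2) ^ j)" by (rule sum_distrib_left[symmetric])
    also have "\<dots> \<le> c / x powr r * 2" using c by (intro mult_left_mono sum_half_powers) auto
    finally show ?thesis by (simp add: mult.commute)
  qed
  show ?thesis
  proof (intro exI[of _ "2 * c"] conjI allI impI)
    show "2 * c > 0" using c by simp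
  qed (rule main; assumption)
qed

section \<open>From rooted graphs to parent maps\<close>

locale rooted_undirected_tree =
  fixes G :: "'a pair_pre_digraph" and \<rho> :: 'a
  assumes tree: "undirected_tree G" and root: "\<rho> \<in> pverts G"

sublocale rooted_undirected_tree \<subseteq> pair_graph G
  using tree by (simp add: undirected_tree_def)

context rooted_undirected_tree
begin

lemma ex_awalk:
  assumes "w \<in> pverts G"
  shows "\<exists>q. awalk \<rho> q w"
proof -
  have "strongly_connected (with_proj (mk_symmetric (with_proj G)))"
    using tree by (simp add: undirected_tree_def connected_def)
  then have "\<rho> \<rightarrow>\<^sup>*\<^bsub>with_proj (mk_symmetric (with_proj G))\<^esub> w"
    using assms root by (auto elim!: strongly_connectedE)
  then have "\<rho> \<rightarrow>\<^sup>*\<^bsub>with_proj G\<^esub> w"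
    using reachable_mk_symmetric_eq[OF sym_arcs] by simp
  then show ?thesis by (simp add: reachable_awalk)
qed

lemma awalk_snoc: "awalk u q v \<Longrightarrow> (v, w) \<in> parcs G \<Longrightarrow> awalk u (q @ [(v, w)]) w"
  using arc_implies_awalk[of "(v, w)"] by (simp add: awalk_appendI)

abbreviation dist_root :: "'a \<Rightarrow> nat" where
  "dist_root \<equiv> graph_dist G \<rho>"

lemma shortest_awalk:
  assumes "w \<in> pverts G"
  obtains q where "awalk \<rho> q w" "length q = dist_root w"
proof -
  have "\<exists>n q. awalk \<rho> q w \<and> length q = n" using ex_awalk[OF assms] by blast
  then have "\<exists>q. awalk \<rho> q w \<and> length q = dist_root w"
    unfolding graph_dist_def by (rule LeastI_ex)
  then show ?thesis using that by blast
qed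

lemma dist_root_le: "awalk \<rho> q w \<Longrightarrow> dist_root w \<le> length q"
  unfolding graph_dist_def by (rule Least_le) blast

lemma dist_root_root: "dist_root \<rho> = 0"
  using dist_root_le[of "[]" \<rho>] root by (simp add: awalk_Nil_iff)

lemma shortest_apath:
  assumes "w \<in> pverts G"
  obtains q where "apath \<rho> q w" "length q = dist_root w"
proof -
  obtain q where q: "awalk \<rho> q w" "length q = dist_root w" using shortest_awalk[OF assms] .
  let ?p = "awalk_to_apath q"
  have p: "apath \<rho> ?p w" using apath_awalk_to_apath[OF q(1)] .
  then have "distinct ?p" using distinct_verts_imp_distinct by (auto simp: apath_def)
  then have "length ?p = card (set ?p)" by (simp add: distinct_card)
  also have "\<dots> \<le> card (set q)" using awalk_to_apath_subset[OF q(1)] by (intro card_mono) auto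
  also have "\<dots> \<le> length q" by (rule card_length)
  finally have "length ?p = dist_root w"
    using q dist_root_le[OF awalkI_apath[OF p]] by simp
  then show ?thesis using p that by blast
qed

text \<open>
  The parent is taken on a shortest path from the root; then the distance to the root decreases along
  parents, which gives acyclicity of the parent map and identifies depth with distance.
\<close>

definition is_parent :: "'a \<Rightarrow> 'a \<Rightarrow> bool" where
  "is_parent v w \<longleftrightarrow> v \<in> pverts G \<and> (v, w) \<in> parcs G \<and> w \<in> children (G, \<rho>) v \<and> dist_root w = Suc (dist_root v)"

lemma ex_parent:
  assumes w: "w \<in> pverts G" "w \<noteq> \<rho>"
  shows "\<exists>v. is_parent v w"
proof -
  obtain q where q: "apath \<rho> q w" "length q = dist_root w" using shortest_apath[OF w(1)] .
  have "q \<noteq> []" using q w by (auto simp: apath_Nil_iff)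
  then obtain q' e where qe: "q = q' @ [e]" by (cases q rule: rev_cases) auto
  define v where "v = fst e"
  have walk: "awalk \<rho> (q' @ [e]) w" using awalkI_apath[OF q(1)] unfolding qe .
  then have e: "e = (v, w)" "(v, w) \<in> parcs G" and q': "awalk \<rho> q' v"
    by (auto simp: awalk_Cons_iff awalk_Nil_iff v_def)
  have v: "v \<in> pverts G" using e(2) in_arcsD1 by auto
  have "dist_root v \<le> length q'" using dist_root_le[OF q'] .
  moreover have "dist_root w \<le> Suc (dist_root v)"
  proof -
    obtain qv where qv: "awalk \<rho> qv v" "length qv = dist_root v" using shortest_awalk[OF v] .
    have "awalk \<rho> (qv @ [(v, w)]) w"
      using awalk_snoc[OF qv(1) e(2)] .
    from dist_root_le[OF this] show ?thesis using qv by simp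
  qed
  ultimately have "dist_root w = Suc (dist_root v)" using q qe by simp
  moreover have "w \<in> children (G, \<rho>) v" using q qe e by (auto simp: children_def)
  ultimately show ?thesis using v e by (auto simp: is_parent_def)
qed

definition parent :: "'a \<Rightarrow> 'a" where
  "parent = (\<lambda>w\<in>pverts G. if w = \<rho> then \<rho> else SOME v. is_parent v w)"

lemma is_parent_parent: "w \<in> pverts G \<Longrightarrow> w \<noteq> \<rho> \<Longrightarrow> is_parent (parent w) w"
  using someI_ex[OF ex_parent, of w] by (simp add: parent_def)

lemma parent_root [simp]: "parent \<rho> = \<rho>"
  using root by (simp add: parent_def)

lemma parent_rtree: "(\<rho>, parent) \<in> rtrees (pverts G)"
proof -
  have "acyclic_on parent (pverts G - {\<rho>})"
    unfolding acyclic_on_def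
  proof (intro allI impI notI)
    fix X assume X: "X \<subseteq> pverts G - {\<rho>}" "X \<noteq> {}" "parent ` X \<subseteq> X"
    obtain x where x: "x \<in> X" "\<And>y. y \<in> X \<Longrightarrow> dist_root x \<le> dist_root y"
      using X(2) ex_has_least_nat[of "\<lambda>x. x \<in> X" _ dist_root] by blast
    have "parent x \<in> X" "x \<in> pverts G" "x \<noteq> \<rho>" using x X by auto
    then show False
      using is_parent_parent[of x] x(2)[of "parent x"] by (simp add: is_parent_def)
  qed
  moreover have "parent w \<in> pverts G" if "w \<in> pverts G" for w
    using is_parent_parent[OF that] root by (cases "w = \<rho>") (auto simp: is_parent_def)
  moreover have "parent \<in> extensional (pverts G)" by (simp add: parent_def)
  ultimately show ?thesis using root by (auto simp: rtrees_def PiE_def)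
qed

sublocale rtree "pverts G" \<rho> parent
  using parent_rtree by unfold_locales

lemma dist_root_iter:
  assumes "w \<in> pverts G" "i \<le> dist_root w"
  shows "dist_root ((parent ^^ i) w) + i = dist_root w"
  using assms(2)
proof (induction i)
  case (Suc i)
  let ?v = "(parent ^^ i) w"
  have "?v \<noteq> \<rho>" using Suc dist_root_root by auto
  then have "is_parent (parent ?v) ?v" using is_parent_parent assms by simp
  then show ?case using Suc by (simp add: is_parent_def)
qed simp

lemma depth_ge_dist_root:
  assumes "w \<in> pverts G"
  shows "depth_ge (\<rho>, parent) (dist_root w) w"
  unfolding depth_ge_def prod.case
proof (intro allI impI notI)
  fix i assume "i < dist_root w" "(parent ^^ i) w = \<rho>"
  then show False using dist_root_iter[OF assms, of i] dist_root_root by auto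
qed

abbreviation parent_arcs :: "('a \<times> 'a) set" where
  "parent_arcs \<equiv> (\<Union>w\<in>pverts G - {\<rho>}. {(parent w, w), (w, parent w)})"

lemma parent_awalk:
  assumes "w \<in> pverts G"
  shows "\<exists>q. awalk \<rho> q w \<and> set q \<subseteq> parent_arcs"
  using assms
proof (induction "dist_root w" arbitrary: w)
  case 0
  have "w = \<rho>"
    using 0 is_parent_parent[of w] by (auto simp: is_parent_def)
  then show ?case using root by (intro exI[of _ "[]"]) (auto simp: awalk_Nil_iff)
next
  case (Suc n w)
  have "w \<noteq> \<rho>" using Suc.hyps(2) dist_root_root by auto
  then have par: "is_parent (parent w) w" using is_parent_parent Suc by blast
  then obtain q where q: "awalk \<rho> q (parent w)" "set q \<subseteq> parent_arcs"
    using Suc.hyps(1)[of "parent w"] Suc.hyps(2) by (auto simp: is_parent_def)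
  have "awalk \<rho> (q @ [(parent w, w)]) w"
    using q par by (intro awalk_snoc) (auto simp: is_parent_def)
  then show ?case using q \<open>w \<noteq> \<rho>\<close> Suc.prems by (intro exI[of _ "q @ [(parent w, w)]"]) auto
qed

text \<open>
  Otherwise the arc would close the path to a cycle of length at least 3.
\<close>

lemma arc_only_apath:
  assumes xy: "(x, y) \<in> parcs G" and q: "apath x q y"
  shows "q = [(x, y)]"
proof (rule ccontr)
  assume neq: "q \<noteq> [(x, y)]"
  have walk: "awalk x q y" using q awalkI_apath by blast
  have "x \<noteq> y" using xy no_loops' by blast
  then have "q \<noteq> []" using walk by (auto simp: awalk_Nil_iff)
  have "length q \<noteq> 1"
  proof
    assume "length q = 1"
    then obtain e where "q = [e]" by (auto simp: length_Suc_conv)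
    then have "q = [(x, y)]" using walk by (cases e) (auto simp: awalk_Cons_iff awalk_Nil_iff)
    then show False using neq by simp
  qed
  then have len: "length (q @ [(y, x)]) \<ge> 3"
    using \<open>q \<noteq> []\<close> by (cases q) (auto simp: Suc_le_eq)
  have yx: "(y, x) \<in> parcs G" using xy arcs_symmetric by blast
  have loop: "awalk x (q @ [(y, x)]) x"
    using awalk_snoc[OF walk yx] .
  have "awalk_verts x (q @ [(y, x)]) = awalk_verts x q @ [x]"
    unfolding awalk_verts_append[OF loop] awlast_of_awalk[OF walk] by simp
  moreover have "awalk_verts x q = x # tl (awalk_verts x q)"
    using walk by (cases q) (auto simp: awalk_Cons_iff)
  moreover have "distinct (awalk_verts x q)" using q by (simp add: apath_def)
  ultimately have "distinct (tl (awalk_verts x (q @ [(y, x)])))"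
    by (metis append_Cons distinct.simps(2) distinct1_rotate list.sel(3) rotate1.simps(2))
  then have "cycle (q @ [(y, x)])" using loop by (auto simp: cycle_def)
  then show False using tree len unfolding undirected_tree_def by blast
qed

text \<open>
  The ends of an arc are joined through the root by a walk along parent arcs.  The path extracted from
  it consists of parent arcs as well, and it can only be the arc itself.
\<close>

lemma parcs_eq: "parcs G = parent_arcs"
proof
  show "parent_arcs \<subseteq> parcs G"
    using is_parent_parent arcs_symmetric by (auto simp: is_parent_def)
  show "parcs G \<subseteq> parent_arcs"
  proof clarify
    fix x y assume xy: "(x, y) \<in> parcs G"
    obtain qx where qx: "awalk \<rho> qx x" "set qx \<subseteq> parent_arcs"
      using parent_awalk in_arcsD1[OF xy] by blast
    obtain qy where qy: "awalk \<rho> qy y" "set qy \<subseteq> parent_arcs"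
      using parent_awalk in_arcsD2[OF xy] by blast
    have "set (rev_path qx) = (\<lambda>(a, b). (b, a)) ` set qx"
      by (induction qx) auto
    then have sub: "set (rev_path qx @ qy) \<subseteq> parent_arcs"
      using qx qy by auto
    have walk: "awalk x (rev_path qx @ qy) y"
      using qx(1) qy(1) awalk_rev_path by (intro awalk_appendI[of _ _ \<rho>]) auto
    have "awalk_to_apath (rev_path qx @ qy) = [(x, y)]"
      by (rule arc_only_apath[OF xy apath_awalk_to_apath[OF walk]])
    then have "(x, y) \<in> set (rev_path qx @ qy)" using awalk_to_apath_subset[OF walk] by auto
    then show "(x, y) \<in> parent_arcs" using sub by blast
  qed
qed

text \<open>
  Every vertex is a child of its parent, so a vertex has at least as many children as preimages under
  the parent map; and a power of a weight \<open>p v \<le> 1\<close> decreases in the exponent.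
\<close>

lemma children_weight_le:
  assumes p: "\<And>v. v \<in> pverts G \<Longrightarrow> 0 < p v \<and> p v \<le> (1 :: real)"
  shows "(\<Prod>v\<in>pverts G. p v ^ card (children (G, \<rho>) v)) \<le> rtree_weight p (pverts G) (\<rho>, parent)"
proof -
  let ?ch = "\<lambda>v. {w \<in> pverts G - {\<rho>}. parent w = v}"
  have "rtree_weight p (pverts G) (\<rho>, parent) =
      (\<Prod>v\<in>pverts G. \<Prod>w\<in>?ch v. p (parent w))"
    unfolding rtree_weight_def prod.case
    by (rule prod.group[symmetric]) (auto simp: pair_finite_verts)
  also have "\<dots> = (\<Prod>v\<in>pverts G. p v ^ card (?ch v))" by simp
  finally have eq: "rtree_weight p (pverts G) (\<rho>, parent) = \<dots>" .
  show ?thesis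
    unfolding eq
  proof (rule prod_mono, intro conjI)
    fix v assume v: "v \<in> pverts G"
    show "0 \<le> p v ^ card (children (G, \<rho>) v)" using p[OF v] by simp
    have "children (G, \<rho>) v \<subseteq> pverts G"
      using awalk_last_in_verts by (auto simp: children_def dest: awalkI_apath)
    then have "finite (children (G, \<rho>) v)" using pair_finite_verts finite_subset by blast
    moreover have "?ch v \<subseteq> children (G, \<rho>) v"
      using is_parent_parent by (auto simp: is_parent_def)
    ultimately have "card (?ch v) \<le> card (children (G, \<rho>) v)" by (rule card_mono)
    then show "p v ^ card (children (G, \<rho>) v) \<le> p v ^ card (?ch v)"
      using p[OF v] by (intro power_decreasing) auto
  qed
qed

end

definition parent_map :: "nat rooted_graph \<Rightarrow> nat \<times> (nat \<Rightarrow> nat)" where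
  "parent_map = (\<lambda>(G, \<rho>). (\<rho>, rooted_undirected_tree.parent G \<rho>))"

lemma rooted_trees_locale:
  "(G, \<rho>) \<in> rooted_trees m \<Longrightarrow> rooted_undirected_tree G \<rho> \<and> pverts G = {1..m}"
  by (auto simp: rooted_trees_def rooted_undirected_tree_def)

lemma parent_map_rtrees: "parent_map ` rooted_trees m \<subseteq> rtrees {1..m}"
proof (rule image_subsetI)
  fix t assume "t \<in> rooted_trees m"
  then obtain G \<rho> where G: "t = (G, \<rho>)" and t: "rooted_undirected_tree G \<rho>" "pverts G = {1..m}"
    using rooted_trees_locale by (cases t) blast
  show "parent_map t \<in> rtrees {1..m}"
    using rooted_undirected_tree.parent_rtree[OF t(1)] t(2) by (simp add: parent_map_def G)
qed

text \<open>
  The parent map determines all arcs by \<open>parcs_eq\<close>.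
\<close>

lemma inj_on_parent_map: "inj_on parent_map (rooted_trees m)"
proof (rule inj_onI, clarify)
  fix G \<rho> G' \<rho>'
  assume G: "(G, \<rho>) \<in> rooted_trees m" and G': "(G', \<rho>') \<in> rooted_trees m"
    and eq: "parent_map (G, \<rho>) = parent_map (G', \<rho>')"
  have t: "rooted_undirected_tree G \<rho>" "rooted_undirected_tree G' \<rho>'" "pverts G = {1..m}" "pverts G' = {1..m}"
    using G G' rooted_trees_locale by auto
  have same: "\<rho> = \<rho>'" "rooted_undirected_tree.parent G \<rho> = rooted_undirected_tree.parent G' \<rho>'"
    using eq by (auto simp: parent_map_def)
  have "parcs G = parcs G'"
    unfolding rooted_undirected_tree.parcs_eq[OF t(1)] rooted_undirected_tree.parcs_eq[OF t(2)]
      t same(1) same(2)[unfolded same(1)] ..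
  then have "G = G'" using t by (intro pair_pre_digraph.equality) auto
  then show "G = G' \<and> \<rho> = \<rho>'" using eq by (simp add: parent_map_def)
qed

lemma p_tree_height_le:
  assumes p: "positive_pmf m p" and N: "\<And>h. y \<le> real h \<Longrightarrow> N \<le> h"
  shows "measure (p_tree_law m p) {t \<in> rooted_trees m. y \<le> real (height t)} \<le>
    sum (rtree_weight p {1..m}) {t \<in> rtrees {1..m}. \<exists>v\<in>{1..m}. depth_ge t N v}"
proof -
  have pos: "p v > 0" if "v \<in> {1..m}" for v using p that by (auto simp: positive_pmf_def)
  have p1: "p v \<le> 1" if "v \<in> {1..m}" for v
  proof -
    have "p v \<le> sum p {1..m}" using that pos by (intro member_le_sum) (auto simp: less_imp_le)
    then show ?thesis using p by (simp add: positive_pmf_def)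
  qed
  let ?w = "\<lambda>t. \<Prod>v\<in>{1..m}. p v ^ card (children t v)"
  let ?E = "{t \<in> rooted_trees m. y \<le> real (height t)}"
  have fin: "finite (rooted_trees m)"
    by (rule inj_on_finite[OF inj_on_parent_map parent_map_rtrees]) simp
  have w0: "?w t \<ge> 0" for t using pos by (intro prod_nonneg) (auto simp: less_imp_le)
  have "measure (p_tree_law m p) ?E = (if ?E \<subseteq> rooted_trees m then sum ?w ?E else 0)"
    unfolding p_tree_law_def using fin w0 by (rule measure_point_measure_finite_if)
  also have "\<dots> = sum ?w ?E" by (rule if_P) blast
  also have "\<dots> \<le> sum (rtree_weight p {1..m}) {t \<in> rtrees {1..m}. \<exists>v\<in>{1..m}. depth_ge t N v}"
  proof (rule sum_le_inj[where \<phi> = parent_map])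
    show "inj_on parent_map ?E" by (rule inj_on_subset[OF inj_on_parent_map]) blast
    show "parent_map ` ?E \<subseteq> {t \<in> rtrees {1..m}. \<exists>v\<in>{1..m}. depth_ge t N v}"
    proof (rule image_subsetI)
      fix t assume t: "t \<in> ?E"
      obtain G \<rho> where G: "t = (G, \<rho>)" by (cases t)
      then have loc: "rooted_undirected_tree G \<rho>" and V: "pverts G = {1..m}"
        using rooted_trees_locale[of G \<rho> m] t by simp_all
      interpret rooted_undirected_tree G \<rho> by (rule loc)
      have "height t \<in> dist_root ` pverts G"
        unfolding height_def G prod.case using pair_finite_verts root by (intro Max_in) auto
      then obtain v where v: "v \<in> pverts G" "height t = dist_root v" by auto
      have "depth_ge (\<rho>, parent) N v"
        using depth_ge_mono[OF depth_ge_dist_root[OF v(1)]] N[of "height t"] t v by auto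
      then show "parent_map t \<in> {t \<in> rtrees {1..m}. \<exists>v\<in>{1..m}. depth_ge t N v}"
        using v parent_map_rtrees t V by (auto simp: parent_map_def G)
    qed
    show "finite {t \<in> rtrees {1..m}. \<exists>v\<in>{1..m}. depth_ge t N v}" by simp
    show "rtree_weight p {1..m} t \<ge> 0" if "t \<in> {t \<in> rtrees {1..m}. \<exists>v\<in>{1..m}. depth_ge t N v}" for t
      using that pos by (intro rtree_weight_nonneg) auto
    fix t assume t: "t \<in> ?E"
    obtain G \<rho> where G: "t = (G, \<rho>)" by (cases t)
    then have loc: "rooted_undirected_tree G \<rho>" and V: "pverts G = {1..m}"
        using rooted_trees_locale[of G \<rho> m] t by simp_all
    interpret rooted_undirected_tree G \<rho> by (rule loc)
    show "?w t \<le> rtree_weight p {1..m} (parent_map t)"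
      using children_weight_le[of p] pos p1 by (auto simp: V G parent_map_def)
  qed
  finally show ?thesis .
qed

section \<open>The height of p-trees\<close>

theorem theorem3p7:
  fixes \<epsilon>\<^sub>0 r\<^sub>0 r :: real
  assumes "0 < \<epsilon>\<^sub>0" and "\<epsilon>\<^sub>0 < 1 / 2" and "2 < r\<^sub>0" and "0 < r"
  shows "\<exists>K::real. K > 0 \<and>
    (\<forall>(m::nat) (p :: nat \<Rightarrow> real).
       m \<ge> 1 \<longrightarrow> positive_pmf m p \<longrightarrow>
       sigma m p \<le> 1 / 2 ^ 20 \<longrightarrow>
       p_max m p / sigma m p powr (3 / 2 + \<epsilon>\<^sub>0) \<le> 1 \<longrightarrow>
       sigma m p powr r\<^sub>0 / p_min m p \<le> 1 \<longrightarrow>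
       (\<forall>x::real. x \<ge> 1 \<longrightarrow>
          measure (p_tree_law m p) {t \<in> rooted_trees m. real (height t) \<ge> x / sigma m p}
            \<le> K / x powr r))"
proof -
  obtain K where K: "K > 0" and tail: "\<forall>(V :: nat set) p s x N.
    finite V \<longrightarrow> (\<forall>i\<in>V. p i > 0) \<longrightarrow> sum p V = 1 \<longrightarrow>
    s > 0 \<longrightarrow> s \<le> 1 / 4 \<longrightarrow> s\<^sup>2 = (\<Sum>i\<in>V. (p i)\<^sup>2) \<longrightarrow>
    (\<forall>i\<in>V. p i \<le> s * sqrt s) \<longrightarrow> (\<forall>i\<in>V. s powr r\<^sub>0 \<le> p i) \<longrightarrow>
    x \<ge> 1 \<longrightarrow> x / s \<le> real N \<longrightarrow>
    sum (rtree_weight p V) {t \<in> rtrees V. \<exists>v\<in>V. depth_ge t N v} \<le> K / x powr r"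
    using rtree_height_tail[where 'a = nat, OF assms(4), of r\<^sub>0] by (elim exE conjE)
  have "measure (p_tree_law m p) {t \<in> rooted_trees m. x / sigma m p \<le> real (height t)} \<le> K / x powr r"
    if m: "m \<ge> 1" and p: "positive_pmf m p" and s: "sigma m p \<le> 1 / 2 ^ 20"
      and pmax: "p_max m p / sigma m p powr (3 / 2 + \<epsilon>\<^sub>0) \<le> 1"
      and pmin: "sigma m p powr r\<^sub>0 / p_min m p \<le> 1" and x: "x \<ge> 1"
    for m p x
  proof -
    let ?s = "sigma m p"
    have pos: "p i > 0" if "i \<in> {1..m}" for i using p that by (auto simp: positive_pmf_def)
    have "(\<Sum>i=1..m. (p i)\<^sup>2) > 0" proof (rule sum_pos)
      show "{1..m} \<noteq> {}" using m by auto
      show "0 < (p i)\<^sup>2" if "i \<in> {1..m}" for i using pos[OF that] by simp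
    qed simp
    then have s0: "?s > 0" and sq: "?s\<^sup>2 = (\<Sum>i=1..m. (p i)\<^sup>2)" by (auto simp: sigma_def)
    have "?s powr (3 / 2 + \<epsilon>\<^sub>0) \<le> ?s powr (3 / 2)"
      using s s0 assms(1) by (intro powr_mono') auto
    also have "\<dots> = ?s powr (1 + 1 / 2)" by simp
    also have "\<dots> = ?s * sqrt ?s" unfolding powr_add using s0 by (simp add: powr_half_sqrt)
    finally have pm: "p_max m p \<le> ?s * sqrt ?s" using pmax s0 by (simp add: divide_le_eq)
    have le_max: "p i \<le> p_max m p" and ge_min: "p_min m p \<le> p i" if "i \<in> {1..m}" for i
      using that by (auto simp: p_max_def p_min_def intro: Max_ge Min_le)
    have "p_min m p \<in> p ` {1..m}" unfolding p_min_def using m by (intro Min_in) auto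
    then have "p_min m p > 0" using pos by auto
    then have pn: "?s powr r\<^sub>0 \<le> p_min m p" using pmin by (simp add: divide_le_eq)
    define N where "N = nat \<lceil>x / ?s\<rceil>"
    have "measure (p_tree_law m p) {t \<in> rooted_trees m. x / ?s \<le> real (height t)} \<le>
        sum (rtree_weight p {1..m}) {t \<in> rtrees {1..m}. \<exists>v\<in>{1..m}. depth_ge t N v}"
      unfolding N_def by (rule p_tree_height_le[OF p]) (simp add: ceiling_le_iff nat_le_iff)
    also have "\<dots> \<le> K / x powr r"
    proof (rule tail[rule_format, where s = ?s])
      show "sum p {1..m} = 1" using p by (simp add: positive_pmf_def)
      show "?s \<le> 1 / 4" using s by (rule order_trans) simp
      show "x / ?s \<le> real N" unfolding N_def by (rule of_nat_ceiling)
      show "p i \<le> ?s * sqrt ?s" if "i \<in> {1..m}" for i using le_max[OF that] pm by (rule order_trans)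
      show "?s powr r\<^sub>0 \<le> p i" if "i \<in> {1..m}" for i using pn ge_min[OF that] by (rule order_trans)
    qed (use pos s0 sq x in auto)
    finally show ?thesis .
  qed
  then show ?thesis using K by (intro exI[of _ K]) auto
qed

end
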